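(* Let $M$ be a nonempty smooth manifold of positive dimension, let $(M,F,g)$ be an $(\alpha,\varepsilon)$-metric manifold with $\alpha=+1$, and let $\mathcal G_g$ be the generalized metric on $\mathbb TM=TM\oplus T^*M$ induced by $g$. Then the generalized almost complex structure $$\mathcal J_{F,g}=\begin{pmatrix}F&-\sqrt2\,\sharp_g\\ \sqrt2\,\flat_g&-\varepsilon F^*\end{pmatrix}$$ is compatible with $\mathcal G_g$ if and only if $\varepsilon=-1$, that is, if and only if $(M,F,g)$ is an almost para-Hermitian manifold. In this case, $(\mathcal J_{F,g},\mathcal G_g)$ is a generalized indefinite almost Hermitian structure and, writing $\phi(\cdot,\cdot)=g(F\cdot,\cdot)$ for the fundamental symplectic structure of $(M,F,g)$, the fundamental symplectic structure of $(\mathcal J_{F,g},\mathcal G_g)$ is $$\Phi_{\mathcal J_{F,g}}(X+\xi,Y+\eta)=-2\sqrt2\,\Omega_0(X+\xi,Y+\eta)+\phi(X,Y)+\phi(\sharp_\phi\xi,\sharp_\phi\eta)$$ for all $X,Y\in\mathfrak X(M)$, $\xi,\eta\in\Lambda^1(M)$.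
   Context: An $(\alpha,\varepsilon)$-metric manifold $(M,F,g)$, $\alpha,\varepsilon\in\{+1,-1\}$, is a smooth manifold with a Riemannian or pseudo-Riemannian (i.e. nondegenerate, not positive definite) metric $g$ and an $\mathfrak F(M)$-linear $F\colon\mathfrak X(M)\to\mathfrak X(M)$ with $F^2=\alpha Id$ and $g(FX,FY)=\varepsilon g(X,Y)$ for all $X,Y$. For $\alpha=+1,\varepsilon=-1$ it is called almost para-Hermitian. $\mathfrak F(M)$, $\mathfrak X(M)$, $\Lambda^1(M)$ denote smooth functions, vector fields, 1-forms; sections of $\mathbb TM$ are written $X+\xi$. For a nondegenerate bilinear form $b$ on $M$: $(\flat_bX)(Y)=b(X,Y)$, $\sharp_b=\flat_b^{-1}$. $(F^*\xi)(X)=\xi(FX)$. Matrix notation: $\begin{pmatrix}H&\sigma\\ \tau&K\end{pmatrix}(X+\xi)=(HX+\sigma\xi)+(\tau X+K\xi)$. $\mathcal G_g(X+\xi,Y+\eta)=g(X,Y)+g(\sharp_g\xi,\sharp_g\eta)$; $\Omega_0(X+\xi,Y+\eta)=\frac12(\xi(Y)-\eta(X))$. A generalized almost complex structure is an $\mathfrak F(M)$-linear endomorphism $\mathcal J$ of $\Gamma(\mathbb TM)$ with $\mathcal J^2=-Id$. Compatible means: there is $\delta\in\{+1,-1\}$ with $\mathcal G(\mathcal Ku,\mathcal Kv)=\delta\,\mathcal G(u,v)$ for all sections $u,v$. $(\mathcal J,\mathcal G)$ with $\mathcal J^2=-Id$ and $\mathcal G$ pseudo-Riemannian is generalized indefinite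 almost Hermitian if $\mathcal G(\mathcal Ju,\mathcal Jv)=\mathcal G(u,v)$ for all $u,v$; its fundamental symplectic structure is $\Phi_{\mathcal J}(u,v)=\mathcal G(\mathcal Ju,v)$ (here with $\mathcal G=\mathcal G_g$). *)

theory Defs
  imports "HOL-Analysis.Analysis" "HOL-Library.Function_Algebras"
begin

section \<open>Smooth manifolds\<close>

text \<open>These two notions are only used for open \<open>S\<close> in a finite-dimensional space, where continuity
  of all iterated directional derivatives is the usual \<open>C\<^sup>k\<close> condition.\<close>

primrec Ck_on :: "nat \<Rightarrow> 'a::real_normed_vector set \<Rightarrow> ('a \<Rightarrow> 'b::real_normed_vector) \<Rightarrow> bool" where
  "Ck_on 0 S f \<longleftrightarrow> continuous_on S f"
| "Ck_on (Suc k) S f \<longleftrightarrow> (\<forall>x\<in>S. f differentiable (at x)) \<and>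
     (\<forall>v. Ck_on k S (\<lambda>x. frechet_derivative f (at x) v))"

definition smooth_on :: "'a::real_normed_vector set \<Rightarrow> ('a \<Rightarrow> 'b::real_normed_vector) \<Rightarrow> bool" where
  "smooth_on S f \<longleftrightarrow> (\<forall>k. Ck_on k S f)"

text \<open>A chart is its domain together with a coordinate map, whose values off the domain are
  irrelevant.\<close>

type_synonym ('m, 'n) chart = "'m set \<times> ('m \<Rightarrow> real ^ 'n)"

definition chart_inv :: "('m, 'n::finite) chart \<Rightarrow> real ^ 'n \<Rightarrow> 'm" where
  "chart_inv c = inv_into (fst c) (snd c)"

definition is_chart :: "('m::topological_space, 'n::finite) chart \<Rightarrow> bool" where
  "is_chart c \<longleftrightarrow> open (fst c) \<and> open (snd c ` fst c) \<and>
     homeomorphism (fst c) (snd c ` fst c) (snd c) (chart_inv c)"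

definition transition ::
    "('m, 'n::finite) chart \<Rightarrow> ('m, 'n) chart \<Rightarrow> real ^ 'n \<Rightarrow> real ^ 'n" where
  "transition c d = snd d \<circ> chart_inv c"

text \<open>The manifold is the whole type \<open>'m\<close>, of dimension \<open>CARD('n)\<close>; it is therefore nonempty and of
  positive dimension. The atlas need not be maximal: up to canonical
  isomorphism, all notions below depend only on the smooth structure which it generates.\<close>

definition smooth_manifold ::
    "('m::{t2_space, second_countable_topology}, 'n::finite) chart set \<Rightarrow> bool" where
  "smooth_manifold A \<longleftrightarrow> (\<forall>c\<in>A. is_chart c) \<and> (\<Union>c\<in>A. fst c) = UNIV \<and>
     (\<forall>c\<in>A. \<forall>d\<in>A. smooth_on (snd c ` (fst c \<inter> fst d)) (transition c d))"

definition smooth_functions :: "('m, 'n::finite) chart set \<Rightarrow> ('m \<Rightarrow> real) set" where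
  "smooth_functions A = {f. \<forall>c\<in>A. smooth_on (snd c ` fst c) (f \<circ> chart_inv c)}"


section \<open>Vector fields, one-forms and sections of the generalized tangent bundle\<close>

text \<open>A tangent vector at \<open>p\<close> assigns to each chart around \<open>p\<close> a coordinate vector, subject to the
  usual transformation law. It is \<open>0\<close> on all other charts, so that equality of functions is
  equality of tangent vectors.\<close>

type_synonym ('m, 'n) tangent = "('m, 'n) chart \<Rightarrow> real ^ 'n"

definition tangent_space ::
    "('m, 'n::finite) chart set \<Rightarrow> 'm \<Rightarrow> ('m, 'n) tangent set" where
  "tangent_space A p = {v.
     (\<forall>c. \<not> (c \<in> A \<and> p \<in> fst c) \<longrightarrow> v c = 0) \<and>
     (\<forall>c\<in>A. \<forall>d\<in>A. p \<in> fst c \<longrightarrow> p \<in> fst d \<longrightarrow>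
        v d = frechet_derivative (transition c d) (at (snd c p)) (v c))}"

type_synonym ('m, 'n) vfield = "'m \<Rightarrow> ('m, 'n) tangent"

definition vector_fields :: "('m, 'n::finite) chart set \<Rightarrow> ('m, 'n) vfield set" where
  "vector_fields A = {X. (\<forall>p. X p \<in> tangent_space A p) \<and>
     (\<forall>c\<in>A. smooth_on (snd c ` fst c) (\<lambda>x. X (chart_inv c x) c))}"

definition vscale :: "('m \<Rightarrow> real) \<Rightarrow> ('m, 'n::finite) vfield \<Rightarrow> ('m, 'n) vfield" where
  "vscale f X = (\<lambda>p c. f p *\<^sub>R X p c)"

text \<open>Linearity over the ring of smooth functions, between modules \<open>\<Gamma>\<close> and \<open>\<Gamma>'\<close> with scalar
  multiplications \<open>s\<close> and \<open>s'\<close>.\<close>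

definition flinear ::
    "('m, 'n::finite) chart set \<Rightarrow>
     (('m \<Rightarrow> real) \<Rightarrow> 's \<Rightarrow> 's) \<Rightarrow> 's::plus set \<Rightarrow>
     (('m \<Rightarrow> real) \<Rightarrow> 't \<Rightarrow> 't) \<Rightarrow> 't::plus set \<Rightarrow> ('s \<Rightarrow> 't) \<Rightarrow> bool" where
  "flinear A s \<Gamma> s' \<Gamma>' T \<longleftrightarrow>
     (\<forall>u\<in>\<Gamma>. T u \<in> \<Gamma>') \<and>
     (\<forall>u\<in>\<Gamma>. \<forall>v\<in>\<Gamma>. T (u + v) = T u + T v) \<and>
     (\<forall>f\<in>smooth_functions A. \<forall>u\<in>\<Gamma>. T (s f u) = s' f (T u))"

text \<open>Tensor fields are treated as multilinear maps on the module of vector fields. In particular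
  one-forms are the elements of the dual module, normalised to be \<open>0\<close> on arguments that are not
  vector fields.\<close>

type_synonym ('m, 'n) oneform = "('m, 'n) vfield \<Rightarrow> 'm \<Rightarrow> real"

definition one_forms :: "('m, 'n::finite) chart set \<Rightarrow> ('m, 'n) oneform set" where
  "one_forms A = {\<xi>. flinear A vscale (vector_fields A) (*) (smooth_functions A) \<xi> \<and>
     (\<forall>X. X \<notin> vector_fields A \<longrightarrow> \<xi> X = 0)}"

definition oscale :: "('m \<Rightarrow> real) \<Rightarrow> ('m, 'n::finite) oneform \<Rightarrow> ('m, 'n) oneform" where
  "oscale f \<xi> = (\<lambda>X p. f p * \<xi> X p)"

type_synonym ('m, 'n) gsection = "('m, 'n) vfield \<times> ('m, 'n) oneform"

definition gsections :: "('m, 'n::finite) chart set \<Rightarrow> ('m, 'n) gsection set" where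
  "gsections A = vector_fields A \<times> one_forms A"

definition gscale :: "('m \<Rightarrow> real) \<Rightarrow> ('m, 'n::finite) gsection \<Rightarrow> ('m, 'n) gsection" where
  "gscale f u = (vscale f (fst u), oscale f (snd u))"


section \<open>Metrics\<close>

text \<open>A bilinear form \<open>b\<close> on sections induces the form \<open>b\<^sub>p(u\<^sub>p, v\<^sub>p) = b(u, v)(p)\<close> on the fibre over
  \<open>p\<close>, because every element of the fibre is the value of a global section. Nondegeneracy and
  definiteness are the pointwise ones; \<open>null p u\<close> expresses \<open>u\<^sub>p = 0\<close>.\<close>

definition bilinear_form ::
    "('m, 'n::finite) chart set \<Rightarrow> (('m \<Rightarrow> real) \<Rightarrow> 's \<Rightarrow> 's) \<Rightarrow> 's::plus set \<Rightarrow>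
     ('s \<Rightarrow> 's \<Rightarrow> 'm \<Rightarrow> real) \<Rightarrow> bool" where
  "bilinear_form A s \<Gamma> b \<longleftrightarrow>
     (\<forall>u\<in>\<Gamma>. flinear A s \<Gamma> (*) (smooth_functions A) (\<lambda>v. b u v)) \<and>
     (\<forall>v\<in>\<Gamma>. flinear A s \<Gamma> (*) (smooth_functions A) (\<lambda>u. b u v))"

definition nondegenerate ::
    "'s set \<Rightarrow> ('m \<Rightarrow> 's \<Rightarrow> bool) \<Rightarrow> ('s \<Rightarrow> 's \<Rightarrow> 'm \<Rightarrow> real) \<Rightarrow> bool" where
  "nondegenerate \<Gamma> null b \<longleftrightarrow> (\<forall>p. \<forall>u\<in>\<Gamma>. (\<forall>v\<in>\<Gamma>. b u v p = 0) \<longrightarrow> null p u)"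

definition positive_definite ::
    "'s set \<Rightarrow> ('m \<Rightarrow> 's \<Rightarrow> bool) \<Rightarrow> ('s \<Rightarrow> 's \<Rightarrow> 'm \<Rightarrow> real) \<Rightarrow> bool" where
  "positive_definite \<Gamma> null b \<longleftrightarrow> (\<forall>p. \<forall>u\<in>\<Gamma>. \<not> null p u \<longrightarrow> b u u p > 0)"

definition symmetric_form :: "'s set \<Rightarrow> ('s \<Rightarrow> 's \<Rightarrow> 'm \<Rightarrow> real) \<Rightarrow> bool" where
  "symmetric_form \<Gamma> b \<longleftrightarrow> (\<forall>u\<in>\<Gamma>. \<forall>v\<in>\<Gamma>. b u v = b v u)"

definition riemannian ::
    "('m, 'n::finite) chart set \<Rightarrow> (('m \<Rightarrow> real) \<Rightarrow> 's \<Rightarrow> 's) \<Rightarrow> 's::plus set \<Rightarrow>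
     ('m \<Rightarrow> 's \<Rightarrow> bool) \<Rightarrow> ('s \<Rightarrow> 's \<Rightarrow> 'm \<Rightarrow> real) \<Rightarrow> bool" where
  "riemannian A s \<Gamma> null b \<longleftrightarrow>
     bilinear_form A s \<Gamma> b \<and> symmetric_form \<Gamma> b \<and> positive_definite \<Gamma> null b"

definition pseudo_riemannian ::
    "('m, 'n::finite) chart set \<Rightarrow> (('m \<Rightarrow> real) \<Rightarrow> 's \<Rightarrow> 's) \<Rightarrow> 's::plus set \<Rightarrow>
     ('m \<Rightarrow> 's \<Rightarrow> bool) \<Rightarrow> ('s \<Rightarrow> 's \<Rightarrow> 'm \<Rightarrow> real) \<Rightarrow> bool" where
  "pseudo_riemannian A s \<Gamma> null b \<longleftrightarrow>
     bilinear_form A s \<Gamma> b \<and> symmetric_form \<Gamma> b \<and>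
     nondegenerate \<Gamma> null b \<and> \<not> positive_definite \<Gamma> null b"

definition vnull :: "'m \<Rightarrow> ('m, 'n::finite) vfield \<Rightarrow> bool" where
  "vnull p X \<longleftrightarrow> X p = 0"

definition gnull :: "'m \<Rightarrow> ('m, 'n::finite) gsection \<Rightarrow> bool" where
  "gnull p u \<longleftrightarrow> fst u p = 0 \<and> (\<forall>Y. snd u Y p = 0)"

type_synonym ('m, 'n) vform = "('m, 'n) vfield \<Rightarrow> ('m, 'n) vfield \<Rightarrow> 'm \<Rightarrow> real"

definition metric_manifold ::
    "('m::{t2_space, second_countable_topology}, 'n::finite) chart set \<Rightarrow> real \<Rightarrow> real \<Rightarrow>
     (('m, 'n) vfield \<Rightarrow> ('m, 'n) vfield) \<Rightarrow> ('m, 'n) vform \<Rightarrow> bool" where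
  "metric_manifold A \<alpha> \<epsilon> F g \<longleftrightarrow>
     smooth_manifold A \<and> \<alpha> \<in> {1, -1} \<and> \<epsilon> \<in> {1, -1} \<and>
     (riemannian A vscale (vector_fields A) vnull g \<or>
      pseudo_riemannian A vscale (vector_fields A) vnull g) \<and>
     flinear A vscale (vector_fields A) vscale (vector_fields A) F \<and>
     (\<forall>X\<in>vector_fields A. F (F X) = vscale (\<lambda>_. \<alpha>) X) \<and>
     (\<forall>X\<in>vector_fields A. \<forall>Y\<in>vector_fields A. \<forall>p. g (F X) (F Y) p = \<epsilon> * g X Y p)"

definition almost_para_hermitian ::
    "('m::{t2_space, second_countable_topology}, 'n::finite) chart set \<Rightarrow>
     (('m, 'n) vfield \<Rightarrow> ('m, 'n) vfield) \<Rightarrow> ('m, 'n) vform \<Rightarrow> bool" where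
  "almost_para_hermitian A F g \<longleftrightarrow> metric_manifold A 1 (-1) F g"

definition flat ::
    "('m, 'n::finite) chart set \<Rightarrow> ('m, 'n) vform \<Rightarrow> ('m, 'n) vfield \<Rightarrow> ('m, 'n) oneform" where
  "flat A b X = (\<lambda>Y. if Y \<in> vector_fields A then b X Y else 0)"

definition sharp ::
    "('m, 'n::finite) chart set \<Rightarrow> ('m, 'n) vform \<Rightarrow> ('m, 'n) oneform \<Rightarrow> ('m, 'n) vfield" where
  "sharp A b = inv_into (vector_fields A) (flat A b)"

definition dual_endo ::
    "('m, 'n::finite) chart set \<Rightarrow> (('m, 'n) vfield \<Rightarrow> ('m, 'n) vfield) \<Rightarrow>
     ('m, 'n) oneform \<Rightarrow> ('m, 'n) oneform" where
  "dual_endo A F \<xi> = (\<lambda>X. if X \<in> vector_fields A then \<xi> (F X) else 0)"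


section \<open>Generalized structures\<close>

definition gmatrix ::
    "(('m, 'n::finite) vfield \<Rightarrow> ('m, 'n) vfield) \<Rightarrow> (('m, 'n) oneform \<Rightarrow> ('m, 'n) vfield) \<Rightarrow>
     (('m, 'n) vfield \<Rightarrow> ('m, 'n) oneform) \<Rightarrow> (('m, 'n) oneform \<Rightarrow> ('m, 'n) oneform) \<Rightarrow>
     ('m, 'n) gsection \<Rightarrow> ('m, 'n) gsection" where
  "gmatrix H \<sigma> \<tau> K u = (H (fst u) + \<sigma> (snd u), \<tau> (fst u) + K (snd u))"

definition gmetric ::
    "('m, 'n::finite) chart set \<Rightarrow> ('m, 'n) vform \<Rightarrow>
     ('m, 'n) gsection \<Rightarrow> ('m, 'n) gsection \<Rightarrow> 'm \<Rightarrow> real" where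
  "gmetric A g u v =
     g (fst u) (fst v) + g (sharp A g (snd u)) (sharp A g (snd v))"

definition Omega0 :: "('m, 'n::finite) gsection \<Rightarrow> ('m, 'n) gsection \<Rightarrow> 'm \<Rightarrow> real" where
  "Omega0 u v p = (snd u (fst v) p - snd v (fst u) p) / 2"

definition generalized_almost_complex ::
    "('m, 'n::finite) chart set \<Rightarrow> (('m, 'n) gsection \<Rightarrow> ('m, 'n) gsection) \<Rightarrow> bool" where
  "generalized_almost_complex A J \<longleftrightarrow>
     flinear A gscale (gsections A) gscale (gsections A) J \<and>
     (\<forall>u\<in>gsections A. J (J u) = - u)"

definition compatible ::
    "('m, 'n::finite) chart set \<Rightarrow> (('m, 'n) gsection \<Rightarrow> ('m, 'n) gsection) \<Rightarrow>
     (('m, 'n) gsection \<Rightarrow> ('m, 'n) gsection \<Rightarrow> 'm \<Rightarrow> real) \<Rightarrow> bool" where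
  "compatible A K G \<longleftrightarrow> (\<exists>\<delta>\<in>{1, -1}. \<forall>u\<in>gsections A. \<forall>v\<in>gsections A. \<forall>p.
     G (K u) (K v) p = \<delta> * G u v p)"

definition generalized_indefinite_almost_hermitian ::
    "('m, 'n::finite) chart set \<Rightarrow> (('m, 'n) gsection \<Rightarrow> ('m, 'n) gsection) \<Rightarrow>
     (('m, 'n) gsection \<Rightarrow> ('m, 'n) gsection \<Rightarrow> 'm \<Rightarrow> real) \<Rightarrow> bool" where
  "generalized_indefinite_almost_hermitian A J G \<longleftrightarrow>
     generalized_almost_complex A J \<and>
     pseudo_riemannian A gscale (gsections A) gnull G \<and>
     (\<forall>u\<in>gsections A. \<forall>v\<in>gsections A. G (J u) (J v) = G u v)"

text \<open>Used both for \<open>\<phi>\<close> on vector fields and for \<open>\<Phi>\<close> on sections of the generalized tangent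
  bundle.\<close>

definition fundamental_form :: "('s \<Rightarrow> 's) \<Rightarrow> ('s \<Rightarrow> 's \<Rightarrow> 'm \<Rightarrow> real) \<Rightarrow> 's \<Rightarrow> 's \<Rightarrow> 'm \<Rightarrow> real" where
  "fundamental_form K b u v = b (K u) v"

definition J_Fg ::
    "('m, 'n::finite) chart set \<Rightarrow> real \<Rightarrow> (('m, 'n) vfield \<Rightarrow> ('m, 'n) vfield) \<Rightarrow>
     ('m, 'n) vform \<Rightarrow> ('m, 'n) gsection \<Rightarrow> ('m, 'n) gsection" where
  "J_Fg A \<epsilon> F g = gmatrix
     F (\<lambda>\<xi>. vscale (\<lambda>_. - sqrt 2) (sharp A g \<xi>))
     (\<lambda>X. oscale (\<lambda>_. sqrt 2) (flat A g X)) (\<lambda>\<xi>. oscale (\<lambda>_. - \<epsilon>) (dual_endo A F \<xi>))"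

end

theory Submission
  imports Defs "HOL-Computational_Algebra.Polynomial"
begin

text \<open>The substantial point is that \<open>\<flat>\<^sub>g\<close> maps vector fields onto the dual module of one-forms, so that
  \<open>\<sharp>\<^sub>g\<close> is a genuine inverse. Multiplying a coordinate frame by a bump function gives global
  vector fields, and Cramer's rule applied to their Gram matrix solves \<open>g(Z, \<cdot>) = D \<xi>\<close> globally with
  \<open>D\<close> smooth and nonzero at a prescribed point; by nondegeneracy the quotients \<open>Z / D\<close> agree on
  overlaps and glue to \<open>\<sharp>\<^sub>g \<xi>\<close>. No partition of unity is needed.

  Writing one-forms as \<open>\<xi> = \<flat>\<^sub>g Z\<close>, one gets
  \<open>\<J>(X, \<flat>\<^sub>g Z) = (FX - \<surd>2 Z, \<flat>\<^sub>g (\<surd>2 X - FZ))\<close> and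
  \<open>\<G>((X, \<flat>\<^sub>g Z), (Y, \<flat>\<^sub>g W)) = g(X, Y) + g(Z, W)\<close>, hence
  \<open>\<G>(\<J>u, \<J>v) = (2 + \<epsilon>) \<G>(u, v) - \<surd>2 (1 + \<epsilon>) (g(X, FW) + g(Z, FY))\<close>. Since \<open>2 + \<epsilon> = \<plusminus>1\<close> only for
  \<open>\<epsilon> = -1\<close>, this decides compatibility.\<close>


section \<open>Smooth maps between normed spaces\<close>

text \<open>On an open set the two functions agree near each point, so their derivatives, taken over
  full neighbourhoods, agree as well.\<close>

lemma Ck_on_cong:
  assumes "open S" "\<And>x. x \<in> S \<Longrightarrow> f x = g x" "Ck_on k S f"
  shows "Ck_on k S g"
  using assms(2,3)
proof (induction k arbitrary: f g)
  case 0
  then show ?case by (simp cong: continuous_on_cong)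
next
  case (Suc k)
  have D: "(g has_derivative frechet_derivative f (at x)) (at x)" if "x \<in> S" for x
  proof (rule has_derivative_transform_within_open[OF _ \<open>open S\<close> that])
    show "(f has_derivative frechet_derivative f (at x)) (at x)"
      using Suc.prems(2) that by (simp add: frechet_derivative_works)
  qed (use Suc.prems(1) in auto)
  then have E: "frechet_derivative g (at x) = frechet_derivative f (at x)" if "x \<in> S" for x
    using frechet_derivative_at that by metis
  have "Ck_on k S (\<lambda>x. frechet_derivative g (at x) v)" for v
    by (rule Suc.IH[of "\<lambda>x. frechet_derivative f (at x) v"]) (use E Suc.prems(2) in auto)
  moreover have "\<forall>x\<in>S. g differentiable (at x)"
    using D differentiable_def by blast
  ultimately show ?case by simp
qed

text \<open>Lets the closure proofs below work with an explicit derivative formula in place of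
  \<open>frechet_derivative\<close>.\<close>

lemma Ck_on_SucI:
  assumes "open S" "\<And>x. x \<in> S \<Longrightarrow> (f has_derivative f' x) (at x)"
    and "\<And>v. Ck_on k S (\<lambda>x. f' x v)"
  shows "Ck_on (Suc k) S f"
proof -
  have E: "f' x = frechet_derivative f (at x)" if "x \<in> S" for x
    using frechet_derivative_at[OF assms(2)[OF that]] .
  have "Ck_on k S (\<lambda>x. frechet_derivative f (at x) v)" for v
    by (rule Ck_on_cong[OF assms(1) _ assms(3)[of v]]) (simp add: E)
  moreover have "\<forall>x\<in>S. f differentiable (at x)"
    using assms(2) differentiable_def by blast
  ultimately show ?thesis by simp
qed

lemma Ck_on_SucD:
  assumes "Ck_on (Suc k) S f"
  shows "\<And>x. x \<in> S \<Longrightarrow> (f has_derivative frechet_derivative f (at x)) (at x)"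
    and "\<And>v. Ck_on k S (\<lambda>x. frechet_derivative f (at x) v)"
  using assms by (simp_all add: frechet_derivative_works)

lemma Ck_on_subset: "Ck_on k S f \<Longrightarrow> T \<subseteq> S \<Longrightarrow> Ck_on k T f"
proof (induction k arbitrary: f)
  case 0
  then show ?case by (simp add: continuous_on_subset)
next
  case (Suc k)
  have "Ck_on k T (\<lambda>x. frechet_derivative f (at x) v)" for v
    using Suc.IH[OF Ck_on_SucD(2)[OF Suc.prems(1)] Suc.prems(2)] .
  with Suc.prems show ?case by auto
qed

lemma Ck_on_Suc_imp: "Ck_on (Suc k) S f \<Longrightarrow> Ck_on k S f"
proof (induction k arbitrary: f)
  case 0
  then show ?case
    by (simp add: continuous_at_imp_continuous_on differentiable_imp_continuous_within)
next
  case (Suc k)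
  from Suc.prems have "\<forall>x\<in>S. f differentiable (at x)"
    and "Ck_on (Suc k) S (\<lambda>x. frechet_derivative f (at x) v)" for v by auto
  with Suc.IH show ?case by simp
qed

text \<open>The gluing rule: differentiability and continuity at a point depend only on a
  neighbourhood of it.\<close>

lemma Ck_on_local:
  assumes "\<And>x. x \<in> S \<Longrightarrow> \<exists>T. open T \<and> x \<in> T \<and> Ck_on k T f"
  shows "Ck_on k S f"
  using assms
proof (induction k arbitrary: f)
  case 0
  then have "continuous (at x) f" if "x \<in> S" for x
    using that continuous_on_eq_continuous_at by fastforce
  then show ?case by (simp add: continuous_at_imp_continuous_on)
next
  case (Suc k)
  have "f differentiable (at x)" if "x \<in> S" for x
    using Suc.prems[OF that] by auto
  moreover have "Ck_on k S (\<lambda>x. frechet_derivative f (at x) v)" for v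
  proof (rule Suc.IH)
    fix x assume "x \<in> S"
    from Suc.prems[OF this] obtain T where "open T" "x \<in> T" "Ck_on (Suc k) T f" by blast
    then show "\<exists>T. open T \<and> x \<in> T \<and> Ck_on k T (\<lambda>x. frechet_derivative f (at x) v)"
      using Ck_on_SucD(2) by blast
  qed
  ultimately show ?case by simp
qed

lemma Ck_on_const: "Ck_on k S (\<lambda>x. c)"
  by (induction k arbitrary: c) simp_all

lemma Ck_on_bounded_linear:
  assumes "bounded_linear h" "open S" "Ck_on k S f"
  shows "Ck_on k S (\<lambda>x. h (f x))"
  using assms(3)
proof (induction k arbitrary: f)
  case 0
  then show ?case by (simp add: bounded_linear.continuous_on[OF assms(1)])
next
  case (Suc k)
  show ?case
    by (rule Ck_on_SucI[OF assms(2) bounded_linear.has_derivative[OF assms(1) Ck_on_SucD(1)[OF Suc.prems]]])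
       (use Suc.IH[OF Ck_on_SucD(2)[OF Suc.prems]] in auto)
qed

lemma Ck_on_ident: "open S \<Longrightarrow> Ck_on k S (\<lambda>x. x)"
proof (cases k)
  case (Suc l)
  assume "open S"
  then show ?thesis
    unfolding Suc by (rule Ck_on_SucI[OF _ has_derivative_ident Ck_on_const])
qed simp

lemma Ck_on_add:
  assumes "open S" "Ck_on k S f" "Ck_on k S g"
  shows "Ck_on k S (\<lambda>x. f x + g x)"
  using assms(2,3)
proof (induction k arbitrary: f g)
  case 0
  then show ?case by (simp add: continuous_on_add)
next
  case (Suc k)
  show ?case
    by (rule Ck_on_SucI[OF assms(1) has_derivative_add[OF Ck_on_SucD(1)[OF Suc.prems(1)] Ck_on_SucD(1)[OF Suc.prems(2)]]])
       (use Suc.IH[OF Ck_on_SucD(2)[OF Suc.prems(1)] Ck_on_SucD(2)[OF Suc.prems(2)]] in auto)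
qed

text \<open>Leibniz rule: each summand of the derivative pairs a derivative with an undifferentiated
  factor, which \<open>Ck_on_Suc_imp\<close> lowers to order \<open>k\<close> for the induction
  hypothesis.\<close>

lemma Ck_on_bilinear:
  assumes "bounded_bilinear h" "open S" "Ck_on k S f" "Ck_on k S g"
  shows "Ck_on k S (\<lambda>x. h (f x) (g x))"
  using assms(3,4)
proof (induction k arbitrary: f g)
  case 0
  then show ?case by (simp add: bounded_bilinear.continuous_on[OF assms(1)])
next
  case (Suc k)
  show ?case
  proof (rule Ck_on_SucI[OF assms(2) bounded_bilinear.FDERIV[OF assms(1)
          Ck_on_SucD(1)[OF Suc.prems(1)] Ck_on_SucD(1)[OF Suc.prems(2)]]], assumption+)
    fix v
    show "Ck_on k S (\<lambda>x. h (f x) (frechet_derivative g (at x) v) +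
        h (frechet_derivative f (at x) v) (g x))"
      by (intro Ck_on_add[OF assms(2)] Suc.IH Ck_on_SucD(2)[OF Suc.prems(1)]
          Ck_on_SucD(2)[OF Suc.prems(2)] Ck_on_Suc_imp[OF Suc.prems(1)] Ck_on_Suc_imp[OF Suc.prems(2)])
  qed
qed

lemma Ck_on_sum:
  assumes "open S" "\<And>i. i \<in> I \<Longrightarrow> Ck_on k S (f i)"
  shows "Ck_on k S (\<lambda>x. \<Sum>i\<in>I. f i x)"
  using assms(2) by (induction I rule: infinite_finite_induct)
    (auto simp: Ck_on_const intro!: Ck_on_add[OF assms(1)])

text \<open>In the chain rule the direction \<open>?f' v\<close> at which the derivative of
  \<open>g\<close> is taken varies with the point, whereas \<open>Ck_on\<close> controls fixed
  directions only. Expanding it in the finite basis of the middle space leaves products of scalar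
  coefficients and derivatives of \<open>g\<close> along basis vectors.\<close>

lemma Ck_on_compose:
  fixes f :: "'a::real_normed_vector \<Rightarrow> 'b::euclidean_space"
    and g :: "'b \<Rightarrow> 'c::real_normed_vector"
  assumes "open S" "open T" "f ` S \<subseteq> T" "Ck_on k S f" "Ck_on k T g"
  shows "Ck_on k S (\<lambda>x. g (f x))"
  using assms(4,5)
proof (induction k arbitrary: g)
  case 0
  then show ?case using assms(3) by (auto intro: continuous_on_compose2)
next
  case (Suc k)
  show ?case
  proof (rule Ck_on_SucI[OF assms(1)])
    fix x assume x: "x \<in> S"
    let ?f' = "frechet_derivative f (at x)" and ?g' = "frechet_derivative g (at (f x))"
    have f': "(f has_derivative ?f') (at x)" and g': "(g has_derivative ?g') (at (f x))"
      using Ck_on_SucD(1)[OF Suc.prems(1)] Ck_on_SucD(1)[OF Suc.prems(2)] x assms(3) by auto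
    interpret L: linear ?g' using g' by (rule has_derivative_linear)
    have "?g' (?f' v) = (\<Sum>b\<in>Basis. (?f' v \<bullet> b) *\<^sub>R ?g' b)" for v
      by (subst euclidean_representation[symmetric]) (simp add: L.sum L.scale)
    with has_derivative_compose[OF f' g']
    show "((\<lambda>x. g (f x)) has_derivative (\<lambda>v. \<Sum>b\<in>Basis.
      (frechet_derivative f (at x) v \<bullet> b) *\<^sub>R frechet_derivative g (at (f x)) b)) (at x)" by simp
  next
    fix v
    show "Ck_on k S (\<lambda>x. \<Sum>b\<in>Basis.
      (frechet_derivative f (at x) v \<bullet> b) *\<^sub>R frechet_derivative g (at (f x)) b)"
      by (intro Ck_on_sum Ck_on_bilinear[OF bounded_bilinear_scaleR] assms(1)
          Ck_on_bounded_linear[OF bounded_linear_inner_left] Ck_on_SucD(2)[OF Suc.prems(1)]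
          Suc.IH Ck_on_Suc_imp[OF Suc.prems(1)] Ck_on_SucD(2)[OF Suc.prems(2)])
  qed
qed

text \<open>The derivative of 1/f is -f'/f^2, so the induction hypothesis for 1/f and the product
  rule suffice.\<close>

lemma Ck_on_inverse:
  fixes f :: "'a::real_normed_vector \<Rightarrow> real"
  assumes "open S" "\<And>x. x \<in> S \<Longrightarrow> f x \<noteq> 0" "Ck_on k S f"
  shows "Ck_on k S (\<lambda>x. inverse (f x))"
  using assms(3)
proof (induction k)
  case 0
  then show ?case using assms(2) by (auto intro: continuous_on_inverse)
next
  case (Suc k)
  show ?case
  proof (rule Ck_on_SucI[OF assms(1) Deriv.has_derivative_inverse[OF assms(2)
      Ck_on_SucD(1)[OF Suc.prems]]], assumption+)
    fix v
    have "Ck_on k S (\<lambda>x. - inverse (f x))"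
      using Ck_on_bounded_linear[OF bounded_linear_minus[OF bounded_linear_ident] assms(1)
          Suc.IH[OF Ck_on_Suc_imp[OF Suc.prems]]] .
    then have "Ck_on k S (\<lambda>x. (- inverse (f x) * frechet_derivative f (at x) v) * inverse (f x))"
      by (intro Ck_on_bilinear[OF bounded_bilinear_mult] assms(1) Ck_on_SucD(2)[OF Suc.prems] Suc.IH
          Ck_on_Suc_imp[OF Suc.prems])
    then show "Ck_on k S (\<lambda>x. - (inverse (f x) * frechet_derivative f (at x) v * inverse (f x)))"
      by simp
  qed
qed

lemma smooth_on_cong: "open S \<Longrightarrow> (\<And>x. x \<in> S \<Longrightarrow> f x = g x) \<Longrightarrow> smooth_on S f \<Longrightarrow> smooth_on S g"
  unfolding smooth_on_def
proof
  fix k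
  assume "open S" "\<And>x. x \<in> S \<Longrightarrow> f x = g x" "\<forall>k. Ck_on k S f"
  then show "Ck_on k S g" using Ck_on_cong[of S f g k] by simp
qed

lemma smooth_on_subset: "smooth_on S f \<Longrightarrow> T \<subseteq> S \<Longrightarrow> smooth_on T f"
  unfolding smooth_on_def using Ck_on_subset by blast

lemma smooth_on_local: "(\<And>x. x \<in> S \<Longrightarrow> \<exists>T. open T \<and> x \<in> T \<and> smooth_on T f) \<Longrightarrow> smooth_on S f"
  unfolding smooth_on_def
proof
  fix k
  assume *: "\<And>x. x \<in> S \<Longrightarrow> \<exists>T. open T \<and> x \<in> T \<and> (\<forall>k. Ck_on k T f)"
  show "Ck_on k S f"
    by (rule Ck_on_local) (use * in blast)
qed

lemma smooth_on_const: "smooth_on S (\<lambda>x. c)"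
  by (simp add: smooth_on_def Ck_on_const)

lemma smooth_on_ident: "open S \<Longrightarrow> smooth_on S (\<lambda>x. x)"
  by (simp add: smooth_on_def Ck_on_ident)

lemma smooth_on_bounded_linear:
  assumes "bounded_linear h" "open S" "smooth_on S f"
  shows "smooth_on S (\<lambda>x. h (f x))"
  using assms(3) unfolding smooth_on_def by - (rule allI, rule Ck_on_bounded_linear[OF assms(1,2)], (erule spec)+)

lemma smooth_on_add:
  "open S \<Longrightarrow> smooth_on S f \<Longrightarrow> smooth_on S g \<Longrightarrow> smooth_on S (\<lambda>x. f x + g x)"
  by (simp add: smooth_on_def Ck_on_add)

lemma smooth_on_bilinear:
  assumes "bounded_bilinear h" "open S" "smooth_on S f" "smooth_on S g"
  shows "smooth_on S (\<lambda>x. h (f x) (g x))"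
  using assms(3,4) unfolding smooth_on_def 
  by - (rule allI, rule Ck_on_bilinear[OF assms(1,2)], (erule spec)+)

lemmas smooth_on_mult = smooth_on_bilinear[OF bounded_bilinear_mult]
lemmas smooth_on_scaleR = smooth_on_bilinear[OF bounded_bilinear_scaleR]

lemma smooth_on_compose:
  fixes f :: "'a::real_normed_vector \<Rightarrow> 'b::euclidean_space"
  assumes "open S" "open T" "f ` S \<subseteq> T" "smooth_on S f" "smooth_on T g"
  shows "smooth_on S (\<lambda>x. g (f x))"
  using assms(4,5) unfolding smooth_on_def 
  by - (rule allI, rule Ck_on_compose[OF assms(1-3)], (erule spec)+)

lemma smooth_on_inverse:
  fixes f :: "'a::real_normed_vector \<Rightarrow> real"
  shows "open S \<Longrightarrow> (\<And>x. x \<in> S \<Longrightarrow> f x \<noteq> 0) \<Longrightarrow> smooth_on S f \<Longrightarrow> smooth_on S (\<lambda>x. inverse (f x))"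
  by (simp add: smooth_on_def Ck_on_inverse)

lemma smooth_on_frechet_derivative:
  assumes "smooth_on S f"
  shows "smooth_on S (\<lambda>x. frechet_derivative f (at x) v)"
  unfolding smooth_on_def
proof
  fix k
  have "Ck_on (Suc k) S f" using assms unfolding smooth_on_def by (rule spec)
  then show "Ck_on k S (\<lambda>x. frechet_derivative f (at x) v)" by (rule Ck_on_SucD(2))
qed

lemma smooth_on_has_derivative:
  assumes "smooth_on S f" "x \<in> S"
  shows "(f has_derivative frechet_derivative f (at x)) (at x)"
proof -
  have "Ck_on (Suc 0) S f" using assms(1) unfolding smooth_on_def by (rule spec)
  from Ck_on_SucD(1)[OF this assms(2)] show ?thesis .
qed

section \<open>A smooth bump function built from exp(-1/t)\<close>

text \<open>The polynomial factor in 1/t makes the family closed under differentiation, so that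
  smoothness follows by an induction over all \<open>q\<close> at once.\<close>

definition flat_exp :: "real poly \<Rightarrow> real \<Rightarrow> real" where
  "flat_exp q t = (if t > 0 then poly q (inverse t) * exp (- inverse t) else 0)"

text \<open>After the substitution x = 1/t, the exponential dominates every polynomial.\<close>

lemma flat_exp_tendsto_0: "(flat_exp q \<longlongrightarrow> 0) (at 0)"
proof -
  have *: "((\<lambda>t::real. poly q (inverse t) * exp (- inverse t)) \<longlongrightarrow> 0) (at_right 0)"
  proof -
    have "((\<lambda>x::real. poly q x / exp x) \<longlongrightarrow> 0) at_top"
    proof (induction q)
      case (pCons a q)
      have "((\<lambda>x::real. \<Sum>i\<le>degree (pCons a q). coeff (pCons a q) i * (x ^ i / exp x)) \<longlongrightarrow> 0) at_top"
        by (intro tendsto_null_sum tendsto_mult_right_zero tendsto_power_div_exp_0)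
      then show ?case by (simp only: poly_altdef sum_divide_distrib times_divide_eq_right)
    qed simp
    from filterlim_compose[OF this filterlim_inverse_at_top_right]
    show ?thesis by (simp add: exp_minus divide_inverse)
  qed
  have "(flat_exp q \<longlongrightarrow> 0) (at_right 0)"
    using * by (rule Lim_transform_eventually)
      (auto simp: flat_exp_def eventually_at_right_less intro!: eventually_mono[OF eventually_at_right_less])
  moreover have "(flat_exp q \<longlongrightarrow> 0) (at_left 0)"
    by (rule Lim_transform_eventually[OF tendsto_const])
      (auto simp: flat_exp_def eventually_at_left_real intro!: eventually_at_leftI[of "-1"])
  ultimately show ?thesis by (simp add: filterlim_split_at)
qed

lemma flat_exp_has_derivative:
  "(flat_exp q has_real_derivative flat_exp (monom 1 2 * (q - pderiv q)) t) (at t)"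
proof -
  consider "t > 0" | "t < 0" | "t = 0" by linarith
  then show ?thesis
  proof cases
    case 1
    show ?thesis
    proof (rule has_field_derivative_transform_within_open[where S="{0<..}"])
      show "((\<lambda>t. poly q (inverse t) * exp (- inverse t)) has_real_derivative
        flat_exp (monom 1 2 * (q - pderiv q)) t) (at t)"
      proof (rule DERIV_cong)
        have inv: "(inverse has_real_derivative - (inverse t)\<^sup>2) (at t)"
          using DERIV_inverse[of t UNIV] 1 by (simp add: numeral_2_eq_2)
        show "((\<lambda>t. poly q (inverse t) * exp (- inverse t)) has_real_derivative
            poly (pderiv q) (inverse t) * - (inverse t)\<^sup>2 * exp (- inverse t) +
            exp (- inverse t) * - (- (inverse t)\<^sup>2) * poly q (inverse t)) (at t)"
          by (rule DERIV_mult[OF DERIV_chain2[OF poly_DERIV inv]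
                DERIV_chain2[OF DERIV_exp DERIV_minus[OF inv]]])
      qed (use 1 in \<open>simp add: flat_exp_def poly_monom algebra_simps\<close>)
    qed (use 1 in \<open>auto simp: flat_exp_def\<close>)
  next
    case 2
    show ?thesis
      by (rule has_field_derivative_transform_within_open[where S="{..<0}" and f="\<lambda>_. 0"])
        (use 2 in \<open>auto simp: flat_exp_def\<close>)
  next
    case 3
    \<comment> \<open>The difference quotient at 0 is again in the family, with \<open>q\<close>
      multiplied by the variable, so it tends to 0.\<close>
    have "(flat_exp q h - flat_exp q 0) / (h - 0) = flat_exp (monom 1 1 * q) h" for h
      by (simp add: flat_exp_def poly_monom field_simps)
    then have "((\<lambda>h. (flat_exp q h - flat_exp q 0) / (h - 0)) \<longlongrightarrow> 0) (at 0)"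
      using flat_exp_tendsto_0 by simp
    then show ?thesis using 3 by (simp add: has_field_derivative_iff flat_exp_def)
  qed
qed

lemma smooth_on_flat_exp: "smooth_on UNIV (flat_exp q)"
  unfolding smooth_on_def
proof
  fix k show "Ck_on k UNIV (flat_exp q)"
  proof (induction k arbitrary: q)
    case 0
    show ?case using DERIV_isCont[OF flat_exp_has_derivative]
      by (simp add: continuous_at_imp_continuous_on)
  next
    case (Suc k)
    show ?case
    proof (rule Ck_on_SucI[where f'="\<lambda>t v. flat_exp (monom 1 2 * (q - pderiv q)) t * v"])
      show "(flat_exp q has_derivative (\<lambda>v. flat_exp (monom 1 2 * (q - pderiv q)) t * v)) (at t)" for t
        using flat_exp_has_derivative by (simp add: has_field_derivative_def)
      show "Ck_on k UNIV (\<lambda>t. flat_exp (monom 1 2 * (q - pderiv q)) t * v)" for v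
        by (rule Ck_on_bounded_linear[OF bounded_linear_mult_left open_UNIV Suc.IH])
    qed simp
  qed
qed

lemma smooth_bump_exists:
  fixes a :: "'a::euclidean_space"
  assumes "r > 0"
  obtains \<psi> :: "'a \<Rightarrow> real" where "smooth_on UNIV \<psi>" "\<psi> a \<noteq> 0" "\<And>x. x \<notin> ball a r \<Longrightarrow> \<psi> x = 0"
proof
  \<comment> \<open>This is r^2 - |x - a|^2, which is positive exactly on the open ball; the inner
    product form makes its smoothness a case of the bilinear rule.\<close>
  let ?q = "\<lambda>x. r\<^sup>2 + (x - a) \<bullet> (a - x)"
  have id: "smooth_on UNIV (\<lambda>x::'a. x)" by (rule smooth_on_ident) simp
  have 1: "smooth_on UNIV (\<lambda>x. x + (-a))"
    by (intro smooth_on_add id smooth_on_const) simp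
  have 2: "smooth_on UNIV (\<lambda>x. - (x + (-a)))"
    by (rule smooth_on_bounded_linear[OF bounded_linear_minus[OF bounded_linear_ident] _ 1]) simp
  have 3: "smooth_on UNIV ?q"
    using smooth_on_add[OF open_UNIV smooth_on_const[of _ "r\<^sup>2"]
      smooth_on_bilinear[OF bounded_bilinear_inner open_UNIV 1 2]] by simp
  show "smooth_on UNIV (\<lambda>x. flat_exp 1 (?q x))"
    by (rule smooth_on_compose[OF _ _ _ 3 smooth_on_flat_exp]) auto
  show "flat_exp 1 (?q a) \<noteq> 0" using assms by (simp add: flat_exp_def)
  show "flat_exp 1 (?q x) = 0" if "x \<notin> ball a r" for x
  proof -
    have "(x - a) \<bullet> (a - x) = - (dist a x)\<^sup>2"
      by (simp add: dist_norm power2_norm_eq_inner inner_diff_left inner_diff_right inner_commute)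
    moreover have "r\<^sup>2 \<le> (dist a x)\<^sup>2" using that assms by (simp add: power_mono)
    ultimately show ?thesis by (simp add: flat_exp_def)
  qed
qed


section \<open>Global sections from charts\<close>

lemma sum_fun_at: "(\<Sum>i\<in>I. f i) x = (\<Sum>i\<in>I. f i x)"
  for f :: "'i \<Rightarrow> 'a \<Rightarrow> 'b::comm_monoid_add"
  by (induction I rule: infinite_finite_induct) auto

section \<open>Charts, transition maps and smooth functions\<close>

locale manifold =
  fixes A :: "('m::{t2_space, second_countable_topology}, 'n::finite) chart set"
  assumes smooth_manifold: "smooth_manifold A"
begin

abbreviation transition_deriv ::
    "('m, 'n) chart \<Rightarrow> ('m, 'n) chart \<Rightarrow> 'm \<Rightarrow> real ^ 'n \<Rightarrow> real ^ 'n" where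
  "transition_deriv c d q \<equiv> frechet_derivative (transition c d) (at (snd c q))"

lemma chart_at: obtains c where "c \<in> A" "p \<in> fst c"
  using smooth_manifold unfolding smooth_manifold_def by blast

lemma chart_homeomorphism:
  "c \<in> A \<Longrightarrow> homeomorphism (fst c) (snd c ` fst c) (snd c) (chart_inv c)"
  using smooth_manifold unfolding smooth_manifold_def is_chart_def by blast

lemma open_chart_domain: "c \<in> A \<Longrightarrow> open (fst c)"
  and open_chart_range: "c \<in> A \<Longrightarrow> open (snd c ` fst c)"
  using smooth_manifold unfolding smooth_manifold_def is_chart_def by blast+

lemma chart_inv_chart [simp]: "c \<in> A \<Longrightarrow> q \<in> fst c \<Longrightarrow> chart_inv c (snd c q) = q"
  using chart_homeomorphism homeomorphism_apply1 by blast

lemma open_chart_image: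
  assumes "c \<in> A" "open U"
  shows "open (snd c ` (fst c \<inter> U))"
proof -
  have "open (snd c ` fst c \<inter> chart_inv c -` U)"
    using chart_homeomorphism[OF assms(1)] open_chart_range[OF assms(1)] assms(2)
    by (intro continuous_open_preimage) (auto simp: homeomorphism_def)
  moreover have "snd c ` fst c \<inter> chart_inv c -` U = snd c ` (fst c \<inter> U)"
    using assms(1) by auto
  ultimately show ?thesis by simp
qed

lemma open_overlap_image: "c \<in> A \<Longrightarrow> d \<in> A \<Longrightarrow> open (snd c ` (fst c \<inter> fst d))"
  by (simp add: open_chart_image open_chart_domain)

lemma transition_smooth:
  "c \<in> A \<Longrightarrow> d \<in> A \<Longrightarrow> smooth_on (snd c ` (fst c \<inter> fst d)) (transition c d)"
  using smooth_manifold unfolding smooth_manifold_def by blast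

lemma transition_chart [simp]: "c \<in> A \<Longrightarrow> q \<in> fst c \<Longrightarrow> transition c d (snd c q) = snd d q"
  by (simp add: transition_def)

lemma transition_has_derivative:
  assumes "c \<in> A" "d \<in> A" "q \<in> fst c" "q \<in> fst d"
  shows "(transition c d has_derivative transition_deriv c d q) (at (snd c q))"
  using smooth_on_has_derivative[OF transition_smooth] assms by blast

lemma transition_deriv_linear:
  assumes "c \<in> A" "d \<in> A" "q \<in> fst c" "q \<in> fst d"
  shows "linear (transition_deriv c d q)"
  using transition_has_derivative[OF assms] by (rule has_derivative_linear)

text \<open>The cocycle rule: the chain rule applied to transition maps, which compose on the image
  of the triple overlap. It is what makes a vector given in one chart a well-defined tangent
  vector.\<close>

lemma transition_deriv_compose:
  assumes "c \<in> A" "d \<in> A" "e \<in> A" "q \<in> fst c" "q \<in> fst d" "q \<in> fst e"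
  shows "transition_deriv d e q (transition_deriv c d q v) = transition_deriv c e q v"
proof -
  let ?T = "snd c ` (fst c \<inter> (fst d \<inter> fst e))"
  have "((\<lambda>x. transition d e (transition c d x)) has_derivative
      (\<lambda>v. transition_deriv d e q (transition_deriv c d q v))) (at (snd c q))"
    using has_derivative_compose[OF transition_has_derivative[OF assms(1,2,4,5)]]
      transition_has_derivative[OF assms(2,3,5,6)] assms by simp
  then have "(transition c e has_derivative
      (\<lambda>v. transition_deriv d e q (transition_deriv c d q v))) (at (snd c q))"
  proof (rule has_derivative_transform_within_open)
    show "open ?T" using assms by (simp add: open_chart_image open_chart_domain open_Int)
  qed (use assms in auto)
  from frechet_derivative_at[OF this] show ?thesis by metis
qed

lemma transition_deriv_self:
  assumes "c \<in> A" "q \<in> fst c"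
  shows "transition_deriv c c q v = v"
proof -
  have "(transition c c has_derivative (\<lambda>v. v)) (at (snd c q))"
    by (rule has_derivative_transform_within_open[OF has_derivative_ident
        open_chart_range[OF assms(1)]]) (use assms in auto)
  from frechet_derivative_at[OF this] show ?thesis by metis
qed

lemma smooth_functionsD:
  "f \<in> smooth_functions A \<Longrightarrow> c \<in> A \<Longrightarrow> smooth_on (snd c ` fst c) (\<lambda>x. f (chart_inv c x))"
  by (simp add: smooth_functions_def o_def)

lemma smooth_functionsI:
  "(\<And>c. c \<in> A \<Longrightarrow> smooth_on (snd c ` fst c) (\<lambda>x. f (chart_inv c x))) \<Longrightarrow> f \<in> smooth_functions A"
  by (simp add: smooth_functions_def o_def)

lemma smooth_functions_const: "(\<lambda>_. k) \<in> smooth_functions A"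
  by (intro smooth_functionsI smooth_on_const)

lemma smooth_functions_add:
  "f \<in> smooth_functions A \<Longrightarrow> h \<in> smooth_functions A \<Longrightarrow> (\<lambda>p. f p + h p) \<in> smooth_functions A"
  by (rule smooth_functionsI, intro smooth_on_add open_chart_range smooth_functionsD)

lemma smooth_functions_mult:
  "f \<in> smooth_functions A \<Longrightarrow> h \<in> smooth_functions A \<Longrightarrow> (\<lambda>p. f p * h p) \<in> smooth_functions A"
  by (rule smooth_functionsI, intro smooth_on_mult open_chart_range smooth_functionsD)

lemma smooth_functions_sum:
  "(\<And>i. i \<in> I \<Longrightarrow> f i \<in> smooth_functions A) \<Longrightarrow> (\<lambda>p. \<Sum>i\<in>I. f i p) \<in> smooth_functions A"
  by (induction I rule: infinite_finite_induct)
    (simp_all add: smooth_functions_const smooth_functions_add)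

lemma smooth_functions_prod:
  "(\<And>i. i \<in> I \<Longrightarrow> f i \<in> smooth_functions A) \<Longrightarrow> (\<lambda>p. \<Prod>i\<in>I. f i p) \<in> smooth_functions A"
  by (induction I rule: infinite_finite_induct)
    (simp_all add: smooth_functions_const smooth_functions_mult)

lemma smooth_functions_det:
  fixes M :: "'m \<Rightarrow> real ^ 'k ^ 'k"
  assumes "\<And>i j. (\<lambda>p. M p $ i $ j) \<in> smooth_functions A"
  shows "(\<lambda>p. det (M p)) \<in> smooth_functions A"
  unfolding det_def
  by (intro smooth_functions_sum smooth_functions_mult smooth_functions_const
      smooth_functions_prod assms)

section \<open>Tangent spaces and the module of vector fields\<close>

lemma tangent_spaceI:
  assumes "\<And>c. \<not> (c \<in> A \<and> p \<in> fst c) \<Longrightarrow> v c = 0"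
    and "\<And>c d. c \<in> A \<Longrightarrow> d \<in> A \<Longrightarrow> p \<in> fst c \<Longrightarrow> p \<in> fst d \<Longrightarrow>
      v d = transition_deriv c d p (v c)"
  shows "v \<in> tangent_space A p"
  unfolding tangent_space_def using assms by blast

lemma tangent_spaceD:
  assumes "v \<in> tangent_space A p"
  shows "\<not> (c \<in> A \<and> p \<in> fst c) \<Longrightarrow> v c = 0"
    and "c \<in> A \<Longrightarrow> d \<in> A \<Longrightarrow> p \<in> fst c \<Longrightarrow> p \<in> fst d \<Longrightarrow> v d = transition_deriv c d p (v c)"
  using assms unfolding tangent_space_def by blast+

lemma tangent_space_zero: "0 \<in> tangent_space A p"
  by (rule tangent_spaceI) (simp_all add: linear_0[OF transition_deriv_linear])

lemma tangent_space_add: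
  assumes "v \<in> tangent_space A p" "w \<in> tangent_space A p"
  shows "v + w \<in> tangent_space A p"
proof (rule tangent_spaceI)
  fix c d assume cd: "c \<in> A" "d \<in> A" "p \<in> fst c" "p \<in> fst d"
  show "(v + w) d = transition_deriv c d p ((v + w) c)"
    using tangent_spaceD(2)[OF assms(1) cd] tangent_spaceD(2)[OF assms(2) cd]
    by (simp add: linear_add[OF transition_deriv_linear[OF cd]])
qed (simp add: tangent_spaceD(1)[OF assms(1)] tangent_spaceD(1)[OF assms(2)])

lemma tangent_space_scale:
  assumes "v \<in> tangent_space A p"
  shows "(\<lambda>c. k *\<^sub>R v c) \<in> tangent_space A p"
proof (rule tangent_spaceI)
  fix c d assume cd: "c \<in> A" "d \<in> A" "p \<in> fst c" "p \<in> fst d"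
  show "k *\<^sub>R v d = transition_deriv c d p (k *\<^sub>R v c)"
    using tangent_spaceD(2)[OF assms(1) cd] by (simp add: linear_cmul[OF transition_deriv_linear[OF cd]])
qed (simp add: tangent_spaceD(1)[OF assms])

text \<open>One chart component determines all others by the transformation law, and components
  outside the charts around \<open>p\<close> are zero by convention.\<close>

lemma tangent_space_eqI:
  assumes "v \<in> tangent_space A p" "w \<in> tangent_space A p" "c \<in> A" "p \<in> fst c" "v c = w c"
  shows "v = w"
proof
  fix d show "v d = w d"
  proof (cases "d \<in> A \<and> p \<in> fst d")
    case True
    then show ?thesis
      using tangent_spaceD(2)[OF assms(1,3), of d] tangent_spaceD(2)[OF assms(2,3), of d] assms(4,5)
      by metis
  next
    case False
    with tangent_spaceD(1)[OF assms(1)] tangent_spaceD(1)[OF assms(2)] show ?thesis by metis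
  qed
qed

lemma vector_fieldsD:
  assumes "X \<in> vector_fields A"
  shows "X p \<in> tangent_space A p"
    and "c \<in> A \<Longrightarrow> smooth_on (snd c ` fst c) (\<lambda>x. X (chart_inv c x) c)"
  using assms unfolding vector_fields_def by blast+

lemma vector_fields_zero: "0 \<in> vector_fields A"
  by (simp add: vector_fields_def tangent_space_zero smooth_on_const)

lemma vector_fields_add:
  "X \<in> vector_fields A \<Longrightarrow> Y \<in> vector_fields A \<Longrightarrow> X + Y \<in> vector_fields A"
  by (simp add: vector_fields_def tangent_space_add smooth_on_add open_chart_range)

lemma vector_fields_scale:
  "f \<in> smooth_functions A \<Longrightarrow> X \<in> vector_fields A \<Longrightarrow> vscale f X \<in> vector_fields A"
  by (simp add: vector_fields_def tangent_space_scale vscale_def smooth_on_scaleR open_chart_range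
      smooth_functionsD)

lemma vector_fields_sum:
  "(\<And>i. i \<in> I \<Longrightarrow> X i \<in> vector_fields A) \<Longrightarrow> (\<Sum>i\<in>I. X i) \<in> vector_fields A"
  by (induction I rule: infinite_finite_induct) (simp_all add: vector_fields_zero vector_fields_add)

section \<open>Extension by zero and cut-off coordinate frames\<close>

text \<open>The domain of \<open>c\<close> and the complement of \<open>K\<close> are open and
  together cover the manifold; on the first \<open>h\<close> is smooth by assumption, on the second
  it vanishes.\<close>

lemma smooth_on_extend_by_zero:
  assumes "c \<in> A" "d \<in> A" "closed K" "K \<subseteq> fst c"
    and smooth: "smooth_on (snd d ` (fst d \<inter> fst c)) h"
    and zero: "\<And>q. q \<in> fst d \<Longrightarrow> q \<notin> K \<Longrightarrow> h (snd d q) = 0"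
  shows "smooth_on (snd d ` fst d) h"
proof (rule smooth_on_local)
  fix x assume "x \<in> snd d ` fst d"
  then obtain q where q: "q \<in> fst d" "x = snd d q" by auto
  show "\<exists>T. open T \<and> x \<in> T \<and> smooth_on T h"
  proof (cases "q \<in> fst c")
    case True
    with q smooth open_overlap_image[OF assms(2,1)] show ?thesis by blast
  next
    case False
    let ?T = "snd d ` (fst d \<inter> - K)"
    have T: "open ?T" using assms by (intro open_chart_image) auto
    have "smooth_on ?T h"
      by (rule smooth_on_cong[OF T _ smooth_on_const[of _ 0]]) (auto simp: zero)
    moreover have "x \<in> ?T" using False q assms(4) by auto
    ultimately show ?thesis using T by blast
  qed
qed

lemma smooth_on_change_chart:
  assumes "c \<in> A" "d \<in> A" "smooth_on T h" "open T" "snd c ` (fst d \<inter> fst c) \<subseteq> T"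
  shows "smooth_on (snd d ` (fst d \<inter> fst c)) (\<lambda>x. h (snd c (chart_inv d x)))"
proof -
  have "smooth_on (snd d ` (fst d \<inter> fst c)) (\<lambda>x. h (transition d c x))"
    by (rule smooth_on_compose[OF open_overlap_image assms(4) _ transition_smooth assms(3)])
      (use assms in auto)
  then show ?thesis by (simp add: transition_def)
qed

text \<open>The closed set \<open>K\<close> is what \<open>smooth_on_extend_by_zero\<close> needs;
  nonvanishing at a chosen point is stated separately where it is used.\<close>

definition bump_in :: "('m, 'n) chart \<Rightarrow> ('m \<Rightarrow> real) \<Rightarrow> bool" where
  "bump_in c \<psi> \<longleftrightarrow> c \<in> A \<and> \<psi> \<in> smooth_functions A \<and>
     (\<exists>K. closed K \<and> K \<subseteq> fst c \<and> (\<forall>q. q \<notin> K \<longrightarrow> \<psi> q = 0))"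

lemma bump_outside: "bump_in c \<psi> \<Longrightarrow> q \<notin> fst c \<Longrightarrow> \<psi> q = 0"
  unfolding bump_in_def by auto

lemma bump_exists:
  assumes c: "c \<in> A" and p: "p \<in> fst c"
  obtains \<psi> where "bump_in c \<psi>" "\<psi> p \<noteq> 0"
proof -
  obtain r where r: "r > 0" "cball (snd c p) r \<subseteq> snd c ` fst c"
    using open_chart_range[OF c] p by (meson imageI open_contains_cball)
  obtain \<phi> :: "real ^ 'n \<Rightarrow> real" where \<phi>: "smooth_on UNIV \<phi>" "\<phi> (snd c p) \<noteq> 0"
      "\<And>x. x \<notin> ball (snd c p) r \<Longrightarrow> \<phi> x = 0"
    using smooth_bump_exists[OF r(1)] by blast
  define \<psi> where "\<psi> q = (if q \<in> fst c then \<phi> (snd c q) else 0)" for q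
  define K where "K = chart_inv c ` cball (snd c p) r"
  have "compact K"
    unfolding K_def using chart_homeomorphism[OF c] r(2)
    by (intro compact_continuous_image) (auto simp: homeomorphism_def intro: continuous_on_subset)
  \<comment> \<open>Closed in the whole manifold, not merely in the chart domain; this uses the
    Hausdorff property.\<close>
  then have K: "closed K" by (rule compact_imp_closed)
  have Kc: "K \<subseteq> fst c" using r(2) c unfolding K_def by auto
  have zero: "\<psi> q = 0" if "q \<notin> K" for q
  proof (rule ccontr)
    assume "\<psi> q \<noteq> 0"
    then have "q \<in> fst c" "snd c q \<in> ball (snd c p) r"
      using \<phi>(3) by (auto simp: \<psi>_def split: if_splits)
    then have "q \<in> K" unfolding K_def using c by (intro image_eqI[of _ _ "snd c q"]) auto
    with that show False by simp
  qed
  have "\<psi> \<in> smooth_functions A"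
  proof (rule smooth_functionsI)
    fix d assume d: "d \<in> A"
    show "smooth_on (snd d ` fst d) (\<lambda>x. \<psi> (chart_inv d x))"
    proof (rule smooth_on_extend_by_zero[OF c d K Kc])
      show "smooth_on (snd d ` (fst d \<inter> fst c)) (\<lambda>x. \<psi> (chart_inv d x))"
        by (rule smooth_on_cong[OF open_overlap_image[OF d c] _ smooth_on_change_chart[OF c d \<phi>(1)]])
          (use d in \<open>auto simp: \<psi>_def\<close>)
    qed (use zero d in auto)
  qed
  then have "bump_in c \<psi>" unfolding bump_in_def using c K Kc zero by blast
  moreover have "\<psi> p \<noteq> 0" using p \<phi>(2) by (simp add: \<psi>_def)
  ultimately show ?thesis using that by blast
qed

text \<open>The field with constant coordinates \<open>v\<close> in the chart \<open>c\<close>, cut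
  off by \<psi> and expressed in every other chart.\<close>

definition coord_field :: "('m, 'n) chart \<Rightarrow> ('m \<Rightarrow> real) \<Rightarrow> real ^ 'n \<Rightarrow> ('m, 'n) vfield" where
  "coord_field c \<psi> v = (\<lambda>q d. if d \<in> A \<and> q \<in> fst d \<and> q \<in> fst c
     then \<psi> q *\<^sub>R transition_deriv c d q v else 0)"

lemma coord_field_self: "c \<in> A \<Longrightarrow> q \<in> fst c \<Longrightarrow> coord_field c \<psi> v q c = \<psi> q *\<^sub>R v"
  by (simp add: coord_field_def transition_deriv_self)

lemma coord_field_vector_field:
  assumes "bump_in c \<psi>"
  shows "coord_field c \<psi> v \<in> vector_fields A"
proof -
  from assms obtain K where c: "c \<in> A" and \<psi>: "\<psi> \<in> smooth_functions A"
      and K: "closed K" "K \<subseteq> fst c" "\<And>q. q \<notin> K \<Longrightarrow> \<psi> q = 0"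
    unfolding bump_in_def by blast
  have "coord_field c \<psi> v q \<in> tangent_space A q" for q
  proof (rule tangent_spaceI)
    fix d e assume de: "d \<in> A" "e \<in> A" "q \<in> fst d" "q \<in> fst e"
    then show "coord_field c \<psi> v q e = transition_deriv d e q (coord_field c \<psi> v q d)"
      using c transition_deriv_compose[of c d e q v] linear_0[OF transition_deriv_linear[OF de]]
      by (simp add: coord_field_def linear_cmul[OF transition_deriv_linear[OF de]])
  qed (auto simp: coord_field_def)
  moreover have "smooth_on (snd d ` fst d) (\<lambda>x. coord_field c \<psi> v (chart_inv d x) d)"
    if d: "d \<in> A" for d
  proof (rule smooth_on_extend_by_zero[OF c d K(1,2)])
    let ?U = "snd d ` (fst d \<inter> fst c)"
    have U: "open ?U" by (rule open_overlap_image[OF d c])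
    have "smooth_on ?U (\<lambda>x. \<psi> (chart_inv d x) *\<^sub>R
        frechet_derivative (transition c d) (at (snd c (chart_inv d x))) v)"
    proof (rule smooth_on_scaleR[OF U])
      show "smooth_on ?U (\<lambda>x. \<psi> (chart_inv d x))"
        by (rule smooth_on_subset[OF smooth_functionsD[OF \<psi> d]]) auto
      show "smooth_on ?U (\<lambda>x. frechet_derivative (transition c d) (at (snd c (chart_inv d x))) v)"
        by (rule smooth_on_change_chart[OF c d
            smooth_on_frechet_derivative[OF transition_smooth[OF c d]] open_overlap_image[OF c d]]) auto
    qed
    then show "smooth_on ?U (\<lambda>x. coord_field c \<psi> v (chart_inv d x) d)"
      by (rule smooth_on_cong[OF U, rotated]) (use d in \<open>auto simp: coord_field_def\<close>)
  qed (use K(3) d in \<open>auto simp: coord_field_def\<close>)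
  ultimately show ?thesis by (simp add: vector_fields_def)
qed

definition coord_comp ::
    "('m, 'n) chart \<Rightarrow> ('m \<Rightarrow> real) \<Rightarrow> ('m, 'n) vfield \<Rightarrow> 'n \<Rightarrow> 'm \<Rightarrow> real" where
  "coord_comp c \<psi> Y j q = \<psi> q * (Y q c $ j)"

lemma coord_comp_smooth:
  assumes "bump_in c \<psi>" "Y \<in> vector_fields A"
  shows "coord_comp c \<psi> Y j \<in> smooth_functions A"
proof (rule smooth_functionsI)
  fix d assume d: "d \<in> A"
  from assms(1) obtain K where c: "c \<in> A" and \<psi>: "\<psi> \<in> smooth_functions A"
      and K: "closed K" "K \<subseteq> fst c" "\<And>q. q \<notin> K \<Longrightarrow> \<psi> q = 0"
    unfolding bump_in_def by blast
  let ?U = "snd d ` (fst d \<inter> fst c)"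
  have U: "open ?U" by (rule open_overlap_image[OF d c])
  show "smooth_on (snd d ` fst d) (\<lambda>x. coord_comp c \<psi> Y j (chart_inv d x))"
  proof (rule smooth_on_extend_by_zero[OF c d K(1,2)])
    have "smooth_on ?U (\<lambda>x. Y (chart_inv c (snd c (chart_inv d x))) c)"
      by (rule smooth_on_change_chart[OF c d vector_fieldsD(2)[OF assms(2) c] open_chart_range[OF c]])
        auto
    then have "smooth_on ?U (\<lambda>x. Y (chart_inv d x) c)"
      by (rule smooth_on_cong[OF U, rotated]) (use c d in auto)
    then have "smooth_on ?U (\<lambda>x. Y (chart_inv d x) c $ j)"
      by (rule smooth_on_bounded_linear[OF bounded_linear_vec_nth U])
    then show "smooth_on ?U (\<lambda>x. coord_comp c \<psi> Y j (chart_inv d x))"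
      unfolding coord_comp_def
      by (intro smooth_on_mult U smooth_on_subset[OF smooth_functionsD[OF \<psi> d]]) auto
  qed (use K(3) d in \<open>auto simp: coord_comp_def\<close>)
qed

text \<open>One factor \<psi> makes the coefficients global and the other makes the frame global,
  hence the square on the left. Outside the chart both sides vanish; inside, it suffices to compare
  components in \<open>c\<close>.\<close>

lemma coord_expansion:
  assumes "bump_in c \<psi>" "Y \<in> vector_fields A"
  shows "vscale (\<lambda>q. \<psi> q * \<psi> q) Y =
    (\<Sum>j\<in>UNIV. vscale (coord_comp c \<psi> Y j) (coord_field c \<psi> (axis j 1)))" (is "?L = ?R")
proof
  fix q
  have c: "c \<in> A" and \<psi>: "\<psi> \<in> smooth_functions A"
    using assms(1) by (auto simp: bump_in_def)
  show "?L q = ?R q"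
  proof (cases "q \<in> fst c")
    case False
    with bump_outside[OF assms(1)] show ?thesis
      by (auto simp: fun_eq_iff vscale_def sum_fun_at coord_field_def)
  next
    case True
    show ?thesis
    proof (rule tangent_space_eqI[OF vector_fieldsD(1) vector_fieldsD(1) c True])
      show "?L \<in> vector_fields A"
        by (intro vector_fields_scale smooth_functions_mult \<psi> assms(2))
      show "?R \<in> vector_fields A"
        by (intro vector_fields_sum vector_fields_scale coord_comp_smooth coord_field_vector_field assms)
      show "?L q c = ?R q c"
        using True c
        by (simp add: vscale_def sum_fun_at coord_field_self coord_comp_def vec_eq_iff axis_def
            if_distrib cong: if_cong)
    qed
  qed
qed

lemma nonvanishing_field_exists:
  obtains X where "X \<in> vector_fields A" "X p \<noteq> 0"
proof -
  obtain c where c: "c \<in> A" "p \<in> fst c" by (rule chart_at)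
  obtain \<psi> where \<psi>: "bump_in c \<psi>" "\<psi> p \<noteq> 0" by (rule bump_exists[OF c])
  \<comment> \<open>Here \<open>1\<close> is the vector with all entries one, nonzero because the
    dimension is positive.\<close>
  let ?X = "coord_field c \<psi> 1"
  have "?X p c \<noteq> 0" using c \<psi>(2) by (simp add: coord_field_self)
  then have "?X p \<noteq> 0" by auto
  with coord_field_vector_field[OF \<psi>(1)] show ?thesis using that by blast
qed

end


section \<open>The musical isomorphisms\<close>

context manifold
begin

text \<open>A one-form without the normalisation off vector fields, so that a bilinear form with one
  argument fixed qualifies directly.\<close>

abbreviation scalar_linear :: "(('m, 'n) vfield \<Rightarrow> 'm \<Rightarrow> real) \<Rightarrow> bool" where
  "scalar_linear \<equiv> flinear A vscale (vector_fields A) (*) (smooth_functions A)"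

lemma scalar_linear_smooth: "scalar_linear T \<Longrightarrow> X \<in> vector_fields A \<Longrightarrow> T X \<in> smooth_functions A"
  by (simp add: flinear_def)

lemma scalar_linear_add:
  "scalar_linear T \<Longrightarrow> X \<in> vector_fields A \<Longrightarrow> Y \<in> vector_fields A \<Longrightarrow> T (X + Y) p = T X p + T Y p"
  by (simp add: flinear_def)

lemma scalar_linear_scale:
  "scalar_linear T \<Longrightarrow> f \<in> smooth_functions A \<Longrightarrow> X \<in> vector_fields A \<Longrightarrow> T (vscale f X) p = f p * T X p"
  by (simp add: flinear_def)

lemma scalar_linear_zero:
  assumes "scalar_linear T"
  shows "T 0 p = 0"
  using scalar_linear_add[OF assms vector_fields_zero vector_fields_zero, of p] by simp

lemma scalar_linear_sum:
  assumes "scalar_linear T"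
    and "\<And>i. i \<in> I \<Longrightarrow> f i \<in> smooth_functions A" "\<And>i. i \<in> I \<Longrightarrow> X i \<in> vector_fields A"
  shows "T (\<Sum>i\<in>I. vscale (f i) (X i)) p = (\<Sum>i\<in>I. f i p * T (X i) p)"
  using assms(2,3)
  by (induction I rule: infinite_finite_induct)
    (simp_all add: scalar_linear_zero[OF assms(1)] scalar_linear_add[OF assms(1)]
      scalar_linear_scale[OF assms(1)] vector_fields_sum vector_fields_scale)

text \<open>Locality of module-linear maps: wherever \<psi> is nonzero, the map is determined by its
  values on the finitely many frame fields.\<close>

lemma scalar_linear_expansion:
  assumes "scalar_linear T" "bump_in c \<psi>" "Y \<in> vector_fields A"
  shows "\<psi> p * \<psi> p * T Y p =
    (\<Sum>j\<in>UNIV. coord_comp c \<psi> Y j p * T (coord_field c \<psi> (axis j 1)) p)"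
proof -
  have "\<psi> \<in> smooth_functions A" using assms(2) by (simp add: bump_in_def)
  then have "\<psi> p * \<psi> p * T Y p = T (vscale (\<lambda>q. \<psi> q * \<psi> q) Y) p"
    using scalar_linear_scale[OF assms(1) smooth_functions_mult assms(3)] by simp
  also have "\<dots> = (\<Sum>j\<in>UNIV. coord_comp c \<psi> Y j p * T (coord_field c \<psi> (axis j 1)) p)"
    unfolding coord_expansion[OF assms(2,3)]
    by (rule scalar_linear_sum[OF assms(1)])
      (simp_all add: coord_comp_smooth coord_field_vector_field assms)
  finally show ?thesis .
qed

lemma scalar_linear_pointwise:
  assumes "scalar_linear T" "Y \<in> vector_fields A" "Y p = 0"
  shows "T Y p = 0"
proof -
  obtain c where c: "c \<in> A" "p \<in> fst c" by (rule chart_at)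
  obtain \<psi> where \<psi>: "bump_in c \<psi>" "\<psi> p \<noteq> 0" by (rule bump_exists[OF c])
  show ?thesis
    using scalar_linear_expansion[OF assms(1) \<psi>(1) assms(2), of p] assms(3) \<psi>(2)
    by (simp add: coord_comp_def)
qed

end

section \<open>Nondegenerate forms and the bijectivity of \<open>flat\<close>\<close>

locale nondegenerate_manifold = manifold A
  for A :: "('m::{t2_space, second_countable_topology}, 'n::finite) chart set" +
  fixes b :: "('m, 'n) vform"
  assumes bilinear: "bilinear_form A vscale (vector_fields A) b"
    and nondegenerate: "nondegenerate (vector_fields A) vnull b"
begin

lemma form_linear_right: "X \<in> vector_fields A \<Longrightarrow> scalar_linear (b X)"
  and form_linear_left: "Y \<in> vector_fields A \<Longrightarrow> scalar_linear (\<lambda>X. b X Y)"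
  using bilinear by (simp_all add: bilinear_form_def)

lemma form_nondegenerate:
  "X \<in> vector_fields A \<Longrightarrow> (\<And>Y. Y \<in> vector_fields A \<Longrightarrow> b X Y p = 0) \<Longrightarrow> X p = 0"
  using nondegenerate unfolding nondegenerate_def vnull_def by blast

text \<open>A kernel vector \<open>x\<close> of the Gram matrix would be the coordinate vector of a
  field orthogonal at \<open>q\<close> to the frame, hence to every field; nondegeneracy makes this
  field vanish at \<open>q\<close>, although its coordinates there are \<psi>(q) x.\<close>

lemma gram_det_nonzero:
  assumes \<psi>: "bump_in c \<psi>" "\<psi> q \<noteq> 0"
  defines "E \<equiv> \<lambda>j. coord_field c \<psi> (axis j 1)"
  shows "det (\<chi> i j. b (E j) (E i) q) \<noteq> 0"
proof
  \<comment> \<open>The indices are arranged so that the matrix acts on the coefficients of the left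
    argument of \<open>b\<close>.\<close>
  let ?M = "\<chi> i j. b (E j) (E i) q"
  have c: "c \<in> A" "q \<in> fst c" using \<psi> bump_outside[OF \<psi>(1)] by (auto simp: bump_in_def)
  have E: "E j \<in> vector_fields A" for j
    unfolding E_def by (rule coord_field_vector_field[OF \<psi>(1)])
  assume "det ?M = 0"
  then obtain x :: "real ^ 'n" where x: "x \<noteq> 0" "?M *v x = 0"
    using invertible_det_nz[of ?M] matrix_left_invertible_ker[of ?M] invertible_left_inverse[of ?M]
    by blast
  define W where "W = (\<Sum>j\<in>UNIV. vscale (\<lambda>_. x $ j) (E j))"
  have W: "W \<in> vector_fields A"
    unfolding W_def by (intro vector_fields_sum vector_fields_scale smooth_functions_const E)
  have bW: "b W (E i) q = 0" for i
  proof -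
    have "b W (E i) q = (\<Sum>j\<in>UNIV. x $ j * b (E j) (E i) q)"
      unfolding W_def by (rule scalar_linear_sum[OF form_linear_left[OF E] smooth_functions_const E])
    also have "\<dots> = (?M *v x) $ i"
      by (simp add: matrix_vector_mult_def mult.commute)
    finally show ?thesis by (simp add: x(2))
  qed
  have "W q = 0"
  proof (rule form_nondegenerate[OF W])
    fix Y assume "Y \<in> vector_fields A"
    from scalar_linear_expansion[OF form_linear_right[OF W] \<psi>(1) this, of q]
    show "b W Y q = 0" using bW \<psi>(2) by (simp add: E_def)
  qed
  moreover have "W q c = \<psi> q *\<^sub>R x"
    using c by (simp add: W_def sum_fun_at vscale_def E_def coord_field_self vec_eq_iff axis_def
        if_distrib cong: if_cong)
  ultimately show False using x(1) \<psi>(2) by simp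
qed

text \<open>By Cramer's rule the dual field of \<open>\<xi>\<close> becomes globally smooth once it is multiplied
  by the Gram determinant of a cut-off coordinate frame; the factor \<open>\<psi>\<^sup>2\<close> makes the identity
  trivial where the cut-off vanishes.\<close>

lemma local_dual_field:
  assumes \<xi>: "scalar_linear \<xi>"
  shows "\<exists>D Z. D \<in> smooth_functions A \<and> D p \<noteq> 0 \<and> Z \<in> vector_fields A \<and>
    (\<forall>Y\<in>vector_fields A. \<forall>q. b Z Y q = D q * \<xi> Y q)"
proof -
  obtain c where c: "c \<in> A" "p \<in> fst c" by (rule chart_at)
  obtain \<psi> where \<psi>: "bump_in c \<psi>" "\<psi> p \<noteq> 0" by (rule bump_exists[OF c])
  define E where "E j = coord_field c \<psi> (axis j 1)" for j
  define M where "M q = (\<chi> i j. b (E j) (E i) q)" for q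
  \<comment> \<open>The Cramer numerators: column \<open>k\<close> of the Gram matrix is replaced by
    the values of \<xi> on the frame.\<close>
  define N where "N k q = det (\<chi> i j. if j = k then \<xi> (E i) q else M q $ i $ j)" for k q
  define D where "D q = \<psi> q * \<psi> q * det (M q)" for q
  define Z where "Z = (\<Sum>k\<in>UNIV. vscale (\<lambda>q. \<psi> q * \<psi> q * N k q) (E k))"
  have \<psi>s: "(\<lambda>q. \<psi> q * \<psi> q) \<in> smooth_functions A"
    using \<psi>(1) by (simp add: bump_in_def smooth_functions_mult)
  have E: "E j \<in> vector_fields A" for j
    unfolding E_def by (rule coord_field_vector_field[OF \<psi>(1)])
  have Ms: "(\<lambda>q. M q $ i $ j) \<in> smooth_functions A" for i j
    unfolding M_def using scalar_linear_smooth[OF form_linear_right[OF E] E] by simp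
  have Ns: "(\<lambda>q. \<psi> q * \<psi> q * N k q) \<in> smooth_functions A" for k
    unfolding N_def
  proof (rule smooth_functions_mult[OF \<psi>s smooth_functions_det])
    fix i j
    show "(\<lambda>q. (\<chi> i j. if j = k then \<xi> (E i) q else M q $ i $ j) $ i $ j) \<in> smooth_functions A"
      using Ms scalar_linear_smooth[OF \<xi> E] by (cases "j = k") simp_all
  qed
  have "D \<in> smooth_functions A"
    unfolding D_def by (intro smooth_functions_mult[OF \<psi>s] smooth_functions_det Ms)
  moreover have "D p \<noteq> 0"
    using gram_det_nonzero[OF \<psi>] \<psi>(2) by (simp add: D_def M_def E_def)
  moreover have Z: "Z \<in> vector_fields A"
    unfolding Z_def by (intro vector_fields_sum vector_fields_scale Ns E)
  moreover have "b Z Y q = D q * \<xi> Y q" if Y: "Y \<in> vector_fields A" for Y q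
  proof (cases "\<psi> q = 0")
    case True
    have "b Z Y q = (\<Sum>k\<in>UNIV. \<psi> q * \<psi> q * N k q * b (E k) Y q)"
      unfolding Z_def by (rule scalar_linear_sum[OF form_linear_left[OF Y] Ns E])
    then show ?thesis using True by (simp add: D_def)
  next
    case False
    define a where "a = (\<chi> k. N k q / det (M q))"
    have det: "det (M q) \<noteq> 0"
      using gram_det_nonzero[OF \<psi>(1) False] by (simp add: M_def E_def)
    have a: "M q *v a = (\<chi> i. \<xi> (E i) q)"
      unfolding cramer[OF det] a_def N_def by (simp add: vec_eq_iff cong: if_cong)
    have ZE: "b Z (E i) q = D q * \<xi> (E i) q" for i
    proof -
      have "b Z (E i) q = (\<Sum>k\<in>UNIV. \<psi> q * \<psi> q * N k q * b (E k) (E i) q)"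
        unfolding Z_def by (rule scalar_linear_sum[OF form_linear_left[OF E] Ns E])
      also have "\<dots> = D q * (M q *v a) $ i"
        using det by (simp add: matrix_vector_mult_def a_def D_def M_def sum_distrib_left mult_ac)
      finally show ?thesis by (simp add: a)
    qed
    \<comment> \<open>The identity passes from the frame to an arbitrary \<open>Y\<close> by
      expanding both sides, at the cost of a factor that is nonzero here.\<close>
    have "\<psi> q * \<psi> q * b Z Y q = (\<Sum>j\<in>UNIV. coord_comp c \<psi> Y j q * (D q * \<xi> (E j) q))"
      unfolding scalar_linear_expansion[OF form_linear_right[OF Z] \<psi>(1) Y] E_def[symmetric] ZE ..
    also have "\<dots> = D q * (\<psi> q * \<psi> q * \<xi> Y q)"
      unfolding scalar_linear_expansion[OF \<xi> \<psi>(1) Y] E_def[symmetric]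
      by (simp add: sum_distrib_left mult_ac)
    finally show ?thesis using False by simp
  qed
  ultimately show ?thesis by blast
qed

text \<open>The local quotients Z/D glue because nondegeneracy makes the dual vector at each point
  unique.\<close>

lemma dual_field_exists:
  assumes \<xi>: "scalar_linear \<xi>"
  obtains X where "X \<in> vector_fields A" "\<And>Y. Y \<in> vector_fields A \<Longrightarrow> b X Y = \<xi> Y"
proof -
  obtain D Z where D: "\<And>p. D p \<in> smooth_functions A" and Dp: "\<And>p. D p p \<noteq> 0"
      and Z: "\<And>p. Z p \<in> vector_fields A"
      and bZ: "\<And>p Y q. Y \<in> vector_fields A \<Longrightarrow> b (Z p) Y q = D p q * \<xi> Y q"
    using local_dual_field[OF \<xi>] by metis
  \<comment> \<open>The difference of the two sides pairs with every \<open>Y\<close> to D p D q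
    \<xi>(Y) - D q D p \<xi>(Y) = 0.\<close>
  have swap: "D p r *\<^sub>R Z q r c = D q r *\<^sub>R Z p r c" for p q r c
  proof -
    let ?W = "vscale (D p) (Z q) + vscale (\<lambda>s. - 1 * D q s) (Z p)"
    have m: "(\<lambda>s. - 1 * D q s) \<in> smooth_functions A"
      by (rule smooth_functions_mult[OF smooth_functions_const D])
    have W: "?W \<in> vector_fields A"
      by (intro vector_fields_add vector_fields_scale D Z m)
    have "?W r = 0"
    proof (rule form_nondegenerate[OF W])
      fix Y assume Y: "Y \<in> vector_fields A"
      show "b ?W Y r = 0"
        using scalar_linear_add[OF form_linear_left[OF Y] vector_fields_scale[OF D Z] vector_fields_scale[OF m Z]]
          scalar_linear_scale[OF form_linear_left[OF Y] D Z] scalar_linear_scale[OF form_linear_left[OF Y] m Z]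
        by (simp add: bZ[OF Y])
    qed
    then have "?W r c = 0" by simp
    then show ?thesis by (simp add: vscale_def)
  qed
  \<comment> \<open>Each point uses its own pair, whose denominator is nonzero there. Smoothness
    cannot be read off, since the pair changes with the point.\<close>
  define X where "X = (\<lambda>q c. inverse (D q q) *\<^sub>R Z q q c)"
  have DX: "D p q *\<^sub>R X q c = Z p q c" for p q c
  proof -
    have "D p q *\<^sub>R X q c = inverse (D q q) *\<^sub>R (D p q *\<^sub>R Z q q c)"
      by (simp add: X_def mult.commute)
    also have "\<dots> = Z p q c" unfolding swap[of p q q c] using Dp[of q] by simp
    finally show ?thesis .
  qed
  have X_eq: "X q c = inverse (D p q) *\<^sub>R Z p q c" if "D p q \<noteq> 0" for p q c
    unfolding DX[symmetric] using that by simp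
  have X: "X \<in> vector_fields A"
  proof -
    have "X q \<in> tangent_space A q" for q
      unfolding X_def by (rule tangent_space_scale[OF vector_fieldsD(1)[OF Z]])
    moreover have "smooth_on (snd c ` fst c) (\<lambda>x. X (chart_inv c x) c)" if c: "c \<in> A" for c
    proof (rule smooth_on_local)
      fix x assume x: "x \<in> snd c ` fst c"
      \<comment> \<open>Near \<open>x\<close> the pair chosen for this one point is kept fixed; on
        the open set \<open>?T\<close>, where its denominator is nonzero, it represents
        \<open>X\<close>.\<close>
      define p where "p = chart_inv c x"
      let ?U = "snd c ` fst c"
      let ?T = "?U \<inter> (\<lambda>x. D p (chart_inv c x)) -` (- {0})"
      have Ds: "smooth_on ?U (\<lambda>x. D p (chart_inv c x))" by (rule smooth_functionsD[OF D c])
      then have "Ck_on 0 ?U (\<lambda>x. D p (chart_inv c x))" unfolding smooth_on_def by (rule spec)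
      then have T: "open ?T"
        by (intro continuous_open_preimage open_chart_range c) auto
      have "smooth_on ?T (\<lambda>x. inverse (D p (chart_inv c x)) *\<^sub>R Z p (chart_inv c x) c)"
      proof (rule smooth_on_scaleR[OF T smooth_on_inverse[OF T]])
        show "smooth_on ?T (\<lambda>x. D p (chart_inv c x))"
          by (rule smooth_on_subset[OF Ds]) auto
        show "smooth_on ?T (\<lambda>x. Z p (chart_inv c x) c)"
          by (rule smooth_on_subset[OF vector_fieldsD(2)[OF Z c]]) auto
      qed auto
      then have "smooth_on ?T (\<lambda>x. X (chart_inv c x) c)"
        by (rule smooth_on_cong[OF T, rotated]) (simp add: X_eq[of p])
      moreover have "x \<in> ?T" using x Dp[of p] by (simp add: p_def)
      ultimately show "\<exists>T. open T \<and> x \<in> T \<and> smooth_on T (\<lambda>x. X (chart_inv c x) c)"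
        using T by blast
    qed
    ultimately show ?thesis by (simp add: vector_fields_def)
  qed
  moreover have "b X Y = \<xi> Y" if Y: "Y \<in> vector_fields A" for Y
  proof
    fix p
    have "vscale (D p) X = Z p"
      by (simp add: fun_eq_iff vscale_def DX)
    then have "D p p * b X Y p = D p p * \<xi> Y p"
      using scalar_linear_scale[OF form_linear_left[OF Y] D X, of p p] bZ[OF Y] by metis
    with Dp show "b X Y p = \<xi> Y p" by simp
  qed
  ultimately show ?thesis using that by blast
qed

lemma flat_one_form: "X \<in> vector_fields A \<Longrightarrow> flat A b X \<in> one_forms A"
  using form_linear_right[of X] vector_fields_add vector_fields_scale
  by (simp add: one_forms_def flinear_def flat_def)

lemma flat_inj: "inj_on (flat A b) (vector_fields A)"
proof (rule inj_onI)
  fix X Y assume XY: "X \<in> vector_fields A" "Y \<in> vector_fields A" "flat A b X = flat A b Y"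
  let ?W = "X + vscale (\<lambda>_. - 1) Y"
  have mY: "vscale (\<lambda>_. - 1) Y \<in> vector_fields A"
    by (rule vector_fields_scale[OF smooth_functions_const XY(2)])
  have W: "?W \<in> vector_fields A" by (rule vector_fields_add[OF XY(1) mY])
  have "?W p = 0" for p
  proof (rule form_nondegenerate[OF W])
    fix V assume V: "V \<in> vector_fields A"
    then have "b X V = b Y V" using fun_cong[OF XY(3), of V] by (simp add: flat_def)
    then show "b ?W V p = 0"
      using scalar_linear_add[OF form_linear_left[OF V] XY(1) mY]
        scalar_linear_scale[OF form_linear_left[OF V] smooth_functions_const XY(2)] by simp
  qed
  then have "?W p c = 0" for p c by (metis zero_fun_apply)
  then show "X = Y" by (simp add: fun_eq_iff vscale_def)
qed

text \<open>Surjectivity is the existence of dual fields; off vector fields, \<open>flat\<close> and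
  one-forms are both normalised to zero.\<close>

lemma flat_bij: "bij_betw (flat A b) (vector_fields A) (one_forms A)"
  unfolding bij_betw_def
proof (intro conjI flat_inj subset_antisym subsetI)
  fix \<xi> assume \<xi>: "\<xi> \<in> one_forms A"
  then obtain X where "X \<in> vector_fields A" "\<And>Y. Y \<in> vector_fields A \<Longrightarrow> b X Y = \<xi> Y"
    using dual_field_exists[of \<xi>] by (auto simp: one_forms_def)
  with \<xi> show "\<xi> \<in> flat A b ` vector_fields A"
    by (intro image_eqI[of _ _ X]) (auto simp: flat_def fun_eq_iff one_forms_def)
qed (auto intro: flat_one_form)

lemma sharp_flat: "X \<in> vector_fields A \<Longrightarrow> sharp A b (flat A b X) = X"
  unfolding sharp_def by (rule inv_into_f_f[OF flat_inj])

lemma one_form_as_flat: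
  assumes "\<xi> \<in> one_forms A"
  obtains X where "X \<in> vector_fields A" "\<xi> = flat A b X"
  using assms flat_bij by (auto simp: bij_betw_def)

end


section \<open>The structure on the generalized tangent bundle\<close>

context nondegenerate_manifold
begin

section \<open>The induced generalized metric in terms of pairs of vector fields\<close>

lemma form_smooth: "X \<in> vector_fields A \<Longrightarrow> Y \<in> vector_fields A \<Longrightarrow> b X Y \<in> smooth_functions A"
  by (rule scalar_linear_smooth[OF form_linear_right])

lemma form_add_left:
  "X \<in> vector_fields A \<Longrightarrow> Y \<in> vector_fields A \<Longrightarrow> V \<in> vector_fields A \<Longrightarrow>
    b (X + Y) V p = b X V p + b Y V p"
  using scalar_linear_add[OF form_linear_left] .

lemma form_add_right:
  "X \<in> vector_fields A \<Longrightarrow> Y \<in> vector_fields A \<Longrightarrow> V \<in> vector_fields A \<Longrightarrow>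
    b V (X + Y) p = b V X p + b V Y p"
  using scalar_linear_add[OF form_linear_right] .

lemma form_scale_left:
  "f \<in> smooth_functions A \<Longrightarrow> X \<in> vector_fields A \<Longrightarrow> V \<in> vector_fields A \<Longrightarrow>
    b (vscale f X) V p = f p * b X V p"
  using scalar_linear_scale[OF form_linear_left] .

lemma form_scale_right:
  "f \<in> smooth_functions A \<Longrightarrow> X \<in> vector_fields A \<Longrightarrow> V \<in> vector_fields A \<Longrightarrow>
    b V (vscale f X) p = f p * b V X p"
  using scalar_linear_scale[OF form_linear_right] .

lemmas form_simps = form_add_left form_add_right form_scale_left form_scale_right
  vector_fields_add vector_fields_scale smooth_functions_const

lemma flat_add:
  "X \<in> vector_fields A \<Longrightarrow> Y \<in> vector_fields A \<Longrightarrow> flat A b (X + Y) = flat A b X + flat A b Y"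
  by (auto simp: flat_def fun_eq_iff form_simps)

lemma flat_scale:
  "f \<in> smooth_functions A \<Longrightarrow> X \<in> vector_fields A \<Longrightarrow> flat A b (vscale f X) = oscale f (flat A b X)"
  by (auto simp: flat_def oscale_def fun_eq_iff form_simps)

lemma flat_apply: "Y \<in> vector_fields A \<Longrightarrow> flat A b X Y = b X Y"
  by (simp add: flat_def)

lemma gsection_flatI:
  "X \<in> vector_fields A \<Longrightarrow> Z \<in> vector_fields A \<Longrightarrow> (X, flat A b Z) \<in> gsections A"
  by (simp add: gsections_def flat_one_form)

lemma gsection_cases:
  assumes "u \<in> gsections A"
  obtains X Z where "X \<in> vector_fields A" "Z \<in> vector_fields A" "u = (X, flat A b Z)"
proof -
  obtain X \<xi> where "u = (X, \<xi>)" "X \<in> vector_fields A" "\<xi> \<in> one_forms A"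
    using assms by (auto simp: gsections_def)
  with one_form_as_flat[of \<xi>] that show ?thesis by metis
qed

lemma gsection_add_flat:
  "Z \<in> vector_fields A \<Longrightarrow> W \<in> vector_fields A \<Longrightarrow>
    (X, flat A b Z) + (Y, flat A b W) = (X + Y, flat A b (Z + W))"
  by (simp add: flat_add)

lemma gsection_scale_flat:
  "f \<in> smooth_functions A \<Longrightarrow> Z \<in> vector_fields A \<Longrightarrow>
    gscale f (X, flat A b Z) = (vscale f X, flat A b (vscale f Z))"
  by (simp add: gscale_def flat_scale)

text \<open>With one-forms written through \<open>flat\<close>, the generalized metric is an
  orthogonal sum of two copies of \<open>b\<close>.\<close>

lemma gmetric_flat:
  "Z \<in> vector_fields A \<Longrightarrow> W \<in> vector_fields A \<Longrightarrow>
    gmetric A b (X, flat A b Z) (Y, flat A b W) p = b X Y p + b Z W p"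
  by (simp add: gmetric_def sharp_flat)

lemma gmetric_bilinear: "bilinear_form A gscale (gsections A) (gmetric A b)"
proof -
  have "flinear A gscale (gsections A) (*) (smooth_functions A) (gmetric A b u)"
    "flinear A gscale (gsections A) (*) (smooth_functions A) (\<lambda>v. gmetric A b v u)"
    if u: "u \<in> gsections A" for u
  proof -
    obtain X Z where X: "X \<in> vector_fields A" and Z: "Z \<in> vector_fields A" and u: "u = (X, flat A b Z)"
      using u by (rule gsection_cases)
    show "flinear A gscale (gsections A) (*) (smooth_functions A) (gmetric A b u)"
      unfolding flinear_def
    proof (intro conjI ballI)
      fix v assume "v \<in> gsections A"
      then obtain Y W where Y: "Y \<in> vector_fields A" and W: "W \<in> vector_fields A"
        and v: "v = (Y, flat A b W)" by (rule gsection_cases)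
      have "gmetric A b u v = (\<lambda>p. b X Y p + b Z W p)"
        using Z W by (simp add: fun_eq_iff u v gmetric_flat)
      then show "gmetric A b u v \<in> smooth_functions A"
        using X Y Z W by (simp add: smooth_functions_add form_smooth)
      show "gmetric A b u (gscale f v) = f * gmetric A b u v" if "f \<in> smooth_functions A" for f
        using that X Y Z W
        by (simp add: fun_eq_iff u v gsection_scale_flat gmetric_flat form_simps distrib_left)
      show "gmetric A b u (v + w) = gmetric A b u v + gmetric A b u w" if "w \<in> gsections A" for w
        using that
      proof (rule gsection_cases)
        fix Y' W' assume "Y' \<in> vector_fields A" "W' \<in> vector_fields A" "w = (Y', flat A b W')"
        then show ?thesis using X Y Z W
          by (simp add: fun_eq_iff u v gsection_add_flat gmetric_flat form_simps del: add_Pair)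
      qed
    qed
    show "flinear A gscale (gsections A) (*) (smooth_functions A) (\<lambda>v. gmetric A b v u)"
      unfolding flinear_def
    proof (intro conjI ballI)
      fix v assume "v \<in> gsections A"
      then obtain Y W where Y: "Y \<in> vector_fields A" and W: "W \<in> vector_fields A"
        and v: "v = (Y, flat A b W)" by (rule gsection_cases)
      have "gmetric A b v u = (\<lambda>p. b Y X p + b W Z p)"
        using Z W by (simp add: fun_eq_iff u v gmetric_flat)
      then show "gmetric A b v u \<in> smooth_functions A"
        using X Y Z W by (simp add: smooth_functions_add form_smooth)
      show "gmetric A b (gscale f v) u = f * gmetric A b v u" if "f \<in> smooth_functions A" for f
        using that X Y Z W
        by (simp add: fun_eq_iff u v gsection_scale_flat gmetric_flat form_simps distrib_left)
      show "gmetric A b (v + w) u = gmetric A b v u + gmetric A b w u" if "w \<in> gsections A" for w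
        using that
      proof (rule gsection_cases)
        fix Y' W' assume "Y' \<in> vector_fields A" "W' \<in> vector_fields A" "w = (Y', flat A b W')"
        then show ?thesis using X Y Z W
          by (simp add: fun_eq_iff u v gsection_add_flat gmetric_flat form_simps del: add_Pair)
      qed
    qed
  qed
  then show ?thesis by (simp add: bilinear_form_def)
qed

text \<open>Testing against sections with one component zero separates the two copies of
  \<open>b\<close>.\<close>

lemma gmetric_nondegenerate: "Defs.nondegenerate (gsections A) gnull (gmetric A b)"
  unfolding nondegenerate_def
proof (intro allI ballI impI)
  fix p u assume "u \<in> gsections A" and orth: "\<forall>v\<in>gsections A. gmetric A b u v p = 0"
  then obtain X Z where X: "X \<in> vector_fields A" and Z: "Z \<in> vector_fields A" and u: "u = (X, flat A b Z)"
    by (blast elim: gsection_cases)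
  have sum0: "b X Y p + b Z W p = 0" if "Y \<in> vector_fields A" "W \<in> vector_fields A" for Y W
    using bspec[OF orth gsection_flatI[OF that]] Z that by (simp add: u gmetric_flat)
  have "X p = 0"
    by (rule form_nondegenerate[OF X])
      (use sum0[OF _ vector_fields_zero] scalar_linear_zero[OF form_linear_right[OF Z]] in simp)
  moreover have Zp: "b Z W p = 0" if "W \<in> vector_fields A" for W
    using sum0[OF vector_fields_zero that] scalar_linear_zero[OF form_linear_right[OF X]] by simp
  ultimately show "gnull p u" by (simp add: gnull_def u flat_def)
qed

lemma form_nonzero:
  obtains X Y p where "X \<in> vector_fields A" "Y \<in> vector_fields A" "b X Y p \<noteq> 0"
proof -
  \<comment> \<open>\<open>undefined\<close> serves as an arbitrary point of the nonempty
    manifold.\<close>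
  obtain X where "X \<in> vector_fields A" "X undefined \<noteq> 0"
    by (rule nonvanishing_field_exists)
  with form_nondegenerate[of X undefined] that show ?thesis by blast
qed

end

section \<open>The operator \<open>J_Fg\<close> for F^2 = Id\<close>

locale product_metric_manifold = nondegenerate_manifold A g
  for A :: "('m::{t2_space, second_countable_topology}, 'n::finite) chart set"
    and g :: "('m, 'n) vform" +
  fixes F :: "('m, 'n) vfield \<Rightarrow> ('m, 'n) vfield" and \<epsilon> :: real
  assumes symmetric: "symmetric_form (vector_fields A) g"
    and F_linear: "flinear A vscale (vector_fields A) vscale (vector_fields A) F"
    and F_F: "X \<in> vector_fields A \<Longrightarrow> F (F X) = X"
    and g_F_F: "X \<in> vector_fields A \<Longrightarrow> Y \<in> vector_fields A \<Longrightarrow> g (F X) (F Y) p = \<epsilon> * g X Y p"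
    and eps: "\<epsilon> \<in> {1, -1}"
begin

lemma F_field: "X \<in> vector_fields A \<Longrightarrow> F X \<in> vector_fields A"
  and F_add: "X \<in> vector_fields A \<Longrightarrow> Y \<in> vector_fields A \<Longrightarrow> F (X + Y) = F X + F Y"
  and F_scale: "f \<in> smooth_functions A \<Longrightarrow> X \<in> vector_fields A \<Longrightarrow> F (vscale f X) = vscale f (F X)"
  using F_linear by (simp_all add: flinear_def)

lemma eps_eps: "\<epsilon> * \<epsilon> = 1"
  using eps by auto

lemma g_sym: "X \<in> vector_fields A \<Longrightarrow> Y \<in> vector_fields A \<Longrightarrow> g X Y p = g Y X p"
  using symmetric by (simp add: symmetric_form_def)

lemma g_F_left:
  "X \<in> vector_fields A \<Longrightarrow> Y \<in> vector_fields A \<Longrightarrow> g (F X) Y p = \<epsilon> * g X (F Y) p"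
  using g_F_F[of X "F Y" p] by (simp add: F_F F_field)

text \<open>The dual of \<open>F\<close> sends the form g(Z, .) to g(Z, F .), which equals
  \<epsilon> g(F Z, .) because \<epsilon> squares to 1.\<close>

lemma dual_endo_flat:
  assumes Z: "Z \<in> vector_fields A"
  shows "dual_endo A F (flat A g Z) = oscale (\<lambda>_. \<epsilon>) (flat A g (F Z))"
proof (intro ext)
  fix Y p
  show "dual_endo A F (flat A g Z) Y p = oscale (\<lambda>_. \<epsilon>) (flat A g (F Z)) Y p"
    using Z eps_eps
    by (simp add: dual_endo_def oscale_def flat_def F_field g_F_left mult.assoc[symmetric])
qed

text \<open>Under the identification of \<open>TM \<oplus> T\<^sup>*M\<close> with \<open>TM \<oplus> TM\<close> by \<open>\<flat>\<^sub>g\<close>, the entry \<open>- \<epsilon> F\<^sup>*\<close> becomes \<open>- F\<close>.\<close>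

lemma J_flat:
  assumes "X \<in> vector_fields A" "Z \<in> vector_fields A"
  shows "J_Fg A \<epsilon> F g (X, flat A g Z) =
    (F X + vscale (\<lambda>_. - sqrt 2) Z,
     flat A g (vscale (\<lambda>_. sqrt 2) X + vscale (\<lambda>_. - 1) (F Z)))"
proof -
  have "oscale (\<lambda>_. - \<epsilon>) (oscale (\<lambda>_. \<epsilon>) \<xi>) = oscale (\<lambda>_. - 1) \<xi>" for \<xi> :: "('m, 'n) oneform"
    using eps_eps by (simp add: oscale_def fun_eq_iff mult.assoc[symmetric])
  then show ?thesis
    using assms by (simp add: J_Fg_def gmatrix_def sharp_flat dual_endo_flat flat_add flat_scale
        F_field vector_fields_scale smooth_functions_const)
qed

lemma vscale_apply: "vscale f X p c = f p *\<^sub>R X p c"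
  by (simp add: vscale_def)

lemmas F_simps = F_field F_add F_scale F_F vector_fields_add vector_fields_scale
  smooth_functions_const

lemma sqrt2_mult: "sqrt 2 * (sqrt 2 * t) = 2 * t"
  by (simp flip: mult.assoc)

text \<open>On pairs of vector fields the matrix has rows (F, -sqrt 2) and (sqrt 2, -F). In its
  square the diagonal entries are F^2 - 2 = -1 and the off-diagonal ones cancel, for either sign of
  \<epsilon>.\<close>

lemma J_almost_complex: "generalized_almost_complex A (J_Fg A \<epsilon> F g)"
  unfolding generalized_almost_complex_def flinear_def
proof (intro conjI ballI)
  fix u assume "u \<in> gsections A"
  then obtain X Z where X: "X \<in> vector_fields A" and Z: "Z \<in> vector_fields A"
    and u: "u = (X, flat A g Z)" by (rule gsection_cases)
  show "J_Fg A \<epsilon> F g u \<in> gsections A"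
    using X Z by (simp add: u J_flat gsection_flatI F_simps)
  show "J_Fg A \<epsilon> F g (u + v) = J_Fg A \<epsilon> F g u + J_Fg A \<epsilon> F g v" if "v \<in> gsections A" for v
    using that
  proof (rule gsection_cases)
    fix Y W assume YW: "Y \<in> vector_fields A" "W \<in> vector_fields A" "v = (Y, flat A g W)"
    have "F (X + Y) + vscale (\<lambda>_. - sqrt 2) (Z + W) =
        (F X + vscale (\<lambda>_. - sqrt 2) Z) + (F Y + vscale (\<lambda>_. - sqrt 2) W)"
      using X Z YW by (simp add: F_simps fun_eq_iff vscale_apply algebra_simps)
    moreover have "vscale (\<lambda>_. sqrt 2) (X + Y) + vscale (\<lambda>_. - 1) (F (Z + W)) =
        (vscale (\<lambda>_. sqrt 2) X + vscale (\<lambda>_. - 1) (F Z)) +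
        (vscale (\<lambda>_. sqrt 2) Y + vscale (\<lambda>_. - 1) (F W))"
      using X Z YW by (simp add: F_simps fun_eq_iff vscale_apply algebra_simps)
    ultimately show ?thesis
      using X Z YW(1,2) unfolding u YW(3)
      by (simp only: gsection_add_flat J_flat F_simps)
  qed
  show "J_Fg A \<epsilon> F g (gscale f u) = gscale f (J_Fg A \<epsilon> F g u)" if f: "f \<in> smooth_functions A" for f
  proof -
    have "F (vscale f X) + vscale (\<lambda>_. - sqrt 2) (vscale f Z) = vscale f (F X + vscale (\<lambda>_. - sqrt 2) Z)"
      using X Z f by (simp add: F_simps fun_eq_iff vscale_apply algebra_simps)
    moreover have "vscale (\<lambda>_. sqrt 2) (vscale f X) + vscale (\<lambda>_. - 1) (F (vscale f Z)) =
        vscale f (vscale (\<lambda>_. sqrt 2) X + vscale (\<lambda>_. - 1) (F Z))"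
      using X Z f by (simp add: F_simps fun_eq_iff vscale_apply algebra_simps)
    ultimately show ?thesis
      using X Z f unfolding u by (simp only: gsection_scale_flat J_flat F_simps)
  qed
  show "J_Fg A \<epsilon> F g (J_Fg A \<epsilon> F g u) = - u"
  proof -
    let ?X = "F X + vscale (\<lambda>_. - sqrt 2) Z"
    let ?Z = "vscale (\<lambda>_. sqrt 2) X + vscale (\<lambda>_. - 1) (F Z)"
    have "F ?X + vscale (\<lambda>_. - sqrt 2) ?Z = - X"
      using X Z by (simp add: F_simps fun_eq_iff vscale_apply vec_eq_iff sqrt2_mult algebra_simps)
    moreover have "vscale (\<lambda>_. sqrt 2) ?X + vscale (\<lambda>_. - 1) (F ?Z) = vscale (\<lambda>_. - 1) Z"
      using X Z by (simp add: F_simps fun_eq_iff vscale_apply vec_eq_iff sqrt2_mult algebra_simps)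
    moreover have "flat A g (vscale (\<lambda>_. - 1) Z) = - flat A g Z"
      using Z by (simp add: flat_scale smooth_functions_const oscale_def fun_eq_iff)
    ultimately show ?thesis
      using X Z unfolding u by (simp add: J_flat F_simps)
  qed
qed

text \<open>The terms without sqrt 2 give the factor \<epsilon> + 2. The four cross terms pair up
  after moving \<open>F\<close> to the right argument, each pair contributing 1 +
  \<epsilon>.\<close>

lemma gmetric_J_J:
  assumes "X \<in> vector_fields A" "Z \<in> vector_fields A" "Y \<in> vector_fields A" "W \<in> vector_fields A"
  shows "gmetric A g (J_Fg A \<epsilon> F g (X, flat A g Z)) (J_Fg A \<epsilon> F g (Y, flat A g W)) p =
    (2 + \<epsilon>) * gmetric A g (X, flat A g Z) (Y, flat A g W) p
    - sqrt 2 * (1 + \<epsilon>) * (g X (F W) p + g Z (F Y) p)"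
proof -
  from assms show ?thesis
    by (simp add: sqrt2_mult J_flat gmetric_flat form_simps F_simps g_F_F g_F_left algebra_simps)
qed

lemma gmetric_J_invariant:
  assumes "\<epsilon> = -1" "u \<in> gsections A" "v \<in> gsections A"
  shows "gmetric A g (J_Fg A \<epsilon> F g u) (J_Fg A \<epsilon> F g v) = gmetric A g u v"
proof -
  obtain X Z where u: "X \<in> vector_fields A" "Z \<in> vector_fields A" "u = (X, flat A g Z)"
    using assms(2) by (rule gsection_cases)
  obtain Y W where v: "Y \<in> vector_fields A" "W \<in> vector_fields A" "v = (Y, flat A g W)"
    using assms(3) by (rule gsection_cases)
  show ?thesis
    unfolding fun_eq_iff u(3) v(3) gmetric_J_J[OF u(1,2) v(1,2)] by (simp add: assms(1))
qed

lemma compatible_iff: "compatible A (J_Fg A \<epsilon> F g) (gmetric A g) \<longleftrightarrow> \<epsilon> = -1"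
proof
  assume "compatible A (J_Fg A \<epsilon> F g) (gmetric A g)"
  then obtain \<delta> where \<delta>: "\<delta> \<in> {1, -1}" and
    G: "\<And>u v p. u \<in> gsections A \<Longrightarrow> v \<in> gsections A \<Longrightarrow>
      gmetric A g (J_Fg A \<epsilon> F g u) (J_Fg A \<epsilon> F g v) p = \<delta> * gmetric A g u v p"
    unfolding compatible_def by blast
  obtain X Y p where XY: "X \<in> vector_fields A" "Y \<in> vector_fields A" "g X Y p \<noteq> 0"
    by (rule form_nonzero)
  note Z = vector_fields_zero
  have z: "g V 0 p = 0" if "V \<in> vector_fields A" for V
    using scalar_linear_zero[OF form_linear_right[OF that]] .
  have "F 0 = 0"
    using F_add[OF Z Z] by simp
  \<comment> \<open>With both one-forms zero the cross terms disappear.\<close>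
  then have "(2 + \<epsilon>) * g X Y p = \<delta> * g X Y p"
    using gmetric_J_J[OF XY(1) Z XY(2) Z, of p] G[OF gsection_flatI gsection_flatI, OF XY(1) Z XY(2) Z, of p]
      z[OF Z] z[OF XY(1)] z[OF F_field[OF XY(2)]] g_sym[OF Z F_field[OF XY(2)], of p]
    by (auto simp: gmetric_flat Z)
  \<comment> \<open>The left side is 1 or 3 and \<delta> is 1 or -1, which leaves \<epsilon> = -1
    and \<delta> = 1.\<close>
  then have "2 + \<epsilon> = \<delta>" using XY(3) by simp
  then show "\<epsilon> = -1" using \<delta> eps by auto
next
  assume "\<epsilon> = -1"
  then have "gmetric A g (J_Fg A \<epsilon> F g u) (J_Fg A \<epsilon> F g v) p = 1 * gmetric A g u v p"
    if "u \<in> gsections A" "v \<in> gsections A" for u v p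
    using gmetric_J_invariant that by simp
  then show "compatible A (J_Fg A \<epsilon> F g) (gmetric A g)"
    unfolding compatible_def by blast
qed

text \<open>Definiteness fails because g(F X, F X) = - g(X, X): at a point where \<open>X\<close> is
  nonzero, one of \<open>X\<close> and \<open>F X\<close> is a nonzero vector of nonpositive
  square.\<close>

lemma gmetric_pseudo_riemannian:
  assumes "\<epsilon> = -1"
  shows "pseudo_riemannian A gscale (gsections A) gnull (gmetric A g)"
  unfolding pseudo_riemannian_def
proof (intro conjI gmetric_bilinear gmetric_nondegenerate)
  show "symmetric_form (gsections A) (gmetric A g)"
    unfolding symmetric_form_def
    by (auto elim!: gsection_cases simp: fun_eq_iff gmetric_flat g_sym)
  obtain X and p :: 'm where X: "X \<in> vector_fields A" "X p \<noteq> 0"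
    by (rule nonvanishing_field_exists)
  obtain V where V: "V \<in> vector_fields A" "V p \<noteq> 0" "g V V p \<le> 0"
  proof (cases "g X X p \<le> 0")
    case True
    with X that show ?thesis by blast
  next
    case False
    have neg: "g (F X) (F X) p < 0" using False X by (simp add: g_F_F assms)
    \<comment> \<open>If \<open>F X\<close> vanished at \<open>p\<close>, then by tensoriality so
      would g(F X, F X).\<close>
    have "F X p \<noteq> 0"
    proof
      assume "F X p = 0"
      from scalar_linear_pointwise[OF form_linear_right[OF F_field[OF X(1)]] F_field[OF X(1)] this] neg
      show False by simp
    qed
    with neg F_field[OF X(1)] that show ?thesis by (metis less_imp_le)
  qed
  have "gmetric A g (V, flat A g 0) (V, flat A g 0) p = g V V p"
    using scalar_linear_zero[OF form_linear_right[OF vector_fields_zero]]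
    by (simp add: gmetric_flat vector_fields_zero)
  with V gsection_flatI[OF V(1) vector_fields_zero]
  show "\<not> positive_definite (gsections A) gnull (gmetric A g)"
    unfolding positive_definite_def gnull_def by (metis fst_conv not_le)
qed

text \<open>The flat map of \<phi> is that of \<open>g\<close> after \<open>F\<close>, so its
  inverse is \<open>F\<close> after the sharp map of \<open>g\<close>. Since \<open>sharp\<close> is
  an \<open>inv_into\<close>, injectivity for \<phi> has to be established first.\<close>

lemma sharp_fundamental_form:
  assumes "Z \<in> vector_fields A"
  shows "sharp A (fundamental_form F g) (flat A g Z) = F Z"
proof -
  have flat: "flat A (fundamental_form F g) X = flat A g (F X)" for X
    by (simp add: flat_def fundamental_form_def fun_eq_iff)
  have "inj_on (flat A (fundamental_form F g)) (vector_fields A)"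
  proof (rule inj_onI)
    fix X Y assume XY: "X \<in> vector_fields A" "Y \<in> vector_fields A"
      "flat A (fundamental_form F g) X = flat A (fundamental_form F g) Y"
    then have "F X = F Y"
      using inj_onD[OF flat_inj, of "F X" "F Y"] by (simp add: flat F_field)
    with F_F[OF XY(1)] F_F[OF XY(2)] show "X = Y" by metis
  qed
  from inv_into_f_f[OF this F_field[OF assms]] show ?thesis
    by (simp add: sharp_def flat F_F assms)
qed

text \<open>For \<xi>, \<eta> dual to Z, W the left side is g(F X, Y) - sqrt 2 g(Z, Y) + sqrt 2 g(X,
  W) - g(F Z, W). The middle terms form the \<open>Omega0\<close> part, and the last one is \<phi>(F
  Z, F W) = g(Z, F W), as \<epsilon> = -1.\<close>

lemma fundamental_form_J:
  assumes "\<epsilon> = -1" "X \<in> vector_fields A" "Y \<in> vector_fields A" "\<xi> \<in> one_forms A" "\<eta> \<in> one_forms A"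
  defines "\<phi> \<equiv> fundamental_form F g"
  shows "fundamental_form (J_Fg A \<epsilon> F g) (gmetric A g) (X, \<xi>) (Y, \<eta>) p =
    - 2 * sqrt 2 * Omega0 (X, \<xi>) (Y, \<eta>) p + \<phi> X Y p + \<phi> (sharp A \<phi> \<xi>) (sharp A \<phi> \<eta>) p"
proof -
  obtain Z where Z: "Z \<in> vector_fields A" "\<xi> = flat A g Z"
    using assms(4) by (rule one_form_as_flat)
  obtain W where W: "W \<in> vector_fields A" "\<eta> = flat A g W"
    using assms(5) by (rule one_form_as_flat)
  show ?thesis
    unfolding \<phi>_def Z(2) W(2) sharp_fundamental_form[OF Z(1)] sharp_fundamental_form[OF W(1)]
      fundamental_form_def J_flat[OF assms(2) Z(1)]
    using assms(1-3) Z(1) W(1) g_sym[OF assms(2) W(1), of p]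
    by (simp add: gmetric_flat form_simps F_simps Omega0_def flat_apply g_F_left
        right_diff_distrib diff_divide_distrib)
qed

end

section \<open>From metric manifolds to the final statement\<close>

text \<open>Reduces the Riemannian and pseudo-Riemannian cases to nondegeneracy; a definite form is
  nondegenerate by testing a field against itself.\<close>

lemma metric_manifold_product:
  assumes "metric_manifold A 1 \<epsilon> F g"
  shows "product_metric_manifold A g F \<epsilon>"
proof -
  from assms have M: "smooth_manifold A" "\<epsilon> \<in> {1, -1}"
    and g: "riemannian A vscale (vector_fields A) vnull g \<or>
      pseudo_riemannian A vscale (vector_fields A) vnull g"
    and F: "flinear A vscale (vector_fields A) vscale (vector_fields A) F"
      "\<And>X. X \<in> vector_fields A \<Longrightarrow> F (F X) = vscale (\<lambda>_. 1) X"
      "\<And>X Y p. X \<in> vector_fields A \<Longrightarrow> Y \<in> vector_fields A \<Longrightarrow> g (F X) (F Y) p = \<epsilon> * g X Y p"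
    by (auto simp: metric_manifold_def)
  have "bilinear_form A vscale (vector_fields A) g" "symmetric_form (vector_fields A) g"
    using g by (auto simp: riemannian_def pseudo_riemannian_def)
  moreover have "nondegenerate (vector_fields A) vnull g"
    using g
  proof
    assume "riemannian A vscale (vector_fields A) vnull g"
    then show ?thesis
      unfolding riemannian_def positive_definite_def nondegenerate_def by (metis less_irrefl)
  qed (simp add: pseudo_riemannian_def)
  ultimately show ?thesis
    using M F by unfold_locales (simp_all add: vscale_def)
qed

theorem proposition4p19:
  fixes A :: "('m::{t2_space, second_countable_topology}, 'n::finite) chart set"
    and F :: "('m, 'n) vfield \<Rightarrow> ('m, 'n) vfield"
    and g :: "('m, 'n) vform"
    and \<epsilon> :: real
  assumes "metric_manifold A 1 \<epsilon> F g"
  shows "generalized_almost_complex A (J_Fg A \<epsilon> F g) \<and>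
    (compatible A (J_Fg A \<epsilon> F g) (gmetric A g) \<longleftrightarrow> \<epsilon> = -1) \<and>
    (\<epsilon> = -1 \<longleftrightarrow> almost_para_hermitian A F g) \<and>
    (\<epsilon> = -1 \<longrightarrow>
      generalized_indefinite_almost_hermitian A (J_Fg A \<epsilon> F g) (gmetric A g) \<and>
      (let \<phi> = fundamental_form F g;
           \<Phi> = fundamental_form (J_Fg A \<epsilon> F g) (gmetric A g)
       in \<forall>X\<in>vector_fields A. \<forall>Y\<in>vector_fields A. \<forall>\<xi>\<in>one_forms A. \<forall>\<eta>\<in>one_forms A. \<forall>p.
            \<Phi> (X, \<xi>) (Y, \<eta>) p =
              - 2 * sqrt 2 * Omega0 (X, \<xi>) (Y, \<eta>) p + \<phi> X Y p
              + \<phi> (sharp A \<phi> \<xi>) (sharp A \<phi> \<eta>) p))"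
proof -
  interpret product_metric_manifold A g F \<epsilon>
    using assms by (rule metric_manifold_product)
  have "\<epsilon> = -1" if "almost_para_hermitian A F g"
  proof -
    \<comment> \<open>The same \<open>F\<close> and \<open>g\<close> now satisfy the metric identity
      with \<epsilon> and with -1; comparing them where \<open>g\<close> is nonzero forces the signs
      to agree.\<close>
    interpret P: product_metric_manifold A g F "-1"
      using that unfolding almost_para_hermitian_def by (rule metric_manifold_product)
    obtain X Y p where XY: "X \<in> vector_fields A" "Y \<in> vector_fields A" "g X Y p \<noteq> 0"
      by (rule form_nonzero)
    then have "(\<epsilon> + 1) * g X Y p = 0"
      using g_F_F[of X Y p] P.g_F_F[of X Y p] by (simp add: distrib_right)
    with XY(3) show ?thesis by simp
  qed
  then have "\<epsilon> = -1 \<longleftrightarrow> almost_para_hermitian A F g"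
    using assms by (auto simp: almost_para_hermitian_def)
  moreover have "generalized_indefinite_almost_hermitian A (J_Fg A \<epsilon> F g) (gmetric A g)" if "\<epsilon> = -1"
    unfolding generalized_indefinite_almost_hermitian_def
    using J_almost_complex gmetric_pseudo_riemannian[OF that] gmetric_J_invariant[OF that] by blast
  ultimately show ?thesis
    unfolding Let_def by (intro conjI impI ballI allI J_almost_complex compatible_iff fundamental_form_J)
qed

end
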